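(* For any unlabeled rooted tree $T$, written as $T=B_+(F)$ with $F$ an unlabeled rooted forest, we have $$\theta_T=\varphi_F,$$ where $\varphi_F=\left.\frac{d}{ds}\Omega(F,s)\right|_{s=0}$ is the coefficient of $s$ in the order polynomial $\Omega(F,s)$ of $F$.
   Context: Rooted trees are finite. $B_+(F)$ is the rooted tree obtained from a rooted forest $F$ (finite disjoint union of rooted trees, possibly empty) by joining all the roots of the trees in $F$ to a new root; $B_+(\emptyset)=\circ$, the one-vertex tree. $v(T)$ is the number of vertices and $E(T)$ the set of edges of $T$. **Order polynomial.** The vertex set of a rooted forest $F$ is a poset: $u\le v$ if $u=v$ or $u$ lies on the path from the root of the component of $v$ to $v$. For a finite poset $P$, $\Omega(P,s)$ is the unique polynomial in $s$ such that for each integer $n\ge1$, $\Omega(P,n)$ is the number of maps $f:P\to\{1,\dots,n\}$ with $f(a)\le f(b)$ whenever $a<b$. **Constants $\theta_T$.** For a rooted tree $T$ and an edge $e$, cutting $e$ splits $T$ into $R_e(T)$ (containing the root) and a tree $P_e(T)$ (rooted at its vertex closest to the root of $T$). For distinct edges write $e\succ e'$ if $e'$ is an edge of $R_e(T)$; $e_1\succ\dots\succ e_{m-1}$ means $e_i\succ e_j$ for all $i<j$. For such a sequence set $S_0=T$, $T_{\vec e,i}=B_+(P_{e_i}(S_{i-1}))$, $S_i=R_{e_i}(S_{i-1})$ for $1\le i\le m-1$, and $T_{\vec e,m}=S_{m-1}$. Define $\theta_T\in\mathbb Q$ by: $\theta_T=0$ if $T=\circ$ or if the root of $T$ has more than one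 child; $\theta_{B_+(\circ)}=1$; and if the root of $T$ has exactly one child and $v(T)\ge 3$, $$\theta_T=1-\sum_{m\ge2}\frac1{m!}\sum_{\substack{(e_1,\dots,e_{m-1})\in E(T)^{m-1}\\ e_1\succ\cdots\succ e_{m-1}}}\theta_{T_{\vec e,1}}\cdots\theta_{T_{\vec e,m}}.$$ *)

theory Defs
  imports "HOL-Computational_Algebra.Polynomial" "HOL-Library.FuncSet"
begin

section \<open>Rooted forests and trees\<close>

text \<open>
  A finite rooted forest is a finite directed graph whose edges are oriented away from the roots;
  an edge \<open>(u, v)\<close> joins the parent \<open>u\<close> to its child \<open>v\<close>. The vertices are natural numbers.
  An unlabeled rooted forest is an isomorphism class of such graphs, so statements about
  unlabeled objects are statements about all representatives, with equality read as \<open>\<cong>\<close>.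
  Every rooted tree arises as some \<open>B_plus F\<close> up to \<open>\<cong>\<close> (\<open>rooted_tree_iso_B_plus\<close> below).
\<close>

record rgraph =
  verts :: "nat set"
  edges :: "(nat \<times> nat) set"

definition rooted_forest :: "rgraph \<Rightarrow> bool" where
  "rooted_forest F \<longleftrightarrow> finite (verts F) \<and> edges F \<subseteq> verts F \<times> verts F \<and>
     acyclic (edges F) \<and> single_valued ((edges F)\<inverse>)"

definition roots :: "rgraph \<Rightarrow> nat set" where
  "roots F = {v \<in> verts F. \<forall>u. (u, v) \<notin> edges F}"

definition rooted_tree :: "rgraph \<Rightarrow> bool" where
  "rooted_tree T \<longleftrightarrow> rooted_forest T \<and> (\<exists>!r. r \<in> roots T)"

definition the_root :: "rgraph \<Rightarrow> nat" where
  "the_root T = (THE r. r \<in> roots T)"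

definition children :: "rgraph \<Rightarrow> nat \<Rightarrow> nat set" where
  "children T v = {w. (v, w) \<in> edges T}"

definition iso :: "rgraph \<Rightarrow> rgraph \<Rightarrow> bool"  (infix "\<cong>" 50) where
  "G \<cong> H \<longleftrightarrow> (\<exists>f. bij_betw f (verts G) (verts H) \<and> edges H = map_prod f f ` edges G)"

definition empty_forest :: rgraph where
  "empty_forest = \<lparr>verts = {}, edges = {}\<rparr>"

text \<open>The old vertices are shifted by \<open>Suc\<close> to make room for the new root \<open>0\<close>.\<close>

definition B_plus :: "rgraph \<Rightarrow> rgraph" where
  "B_plus F = \<lparr>verts = insert 0 (Suc ` verts F),
               edges = (\<lambda>r. (0, Suc r)) ` roots F \<union> map_prod Suc Suc ` edges F\<rparr>"

abbreviation one_vertex :: rgraph where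
  "one_vertex \<equiv> B_plus empty_forest"


section \<open>The order polynomial\<close>

definition order_maps :: "nat set \<Rightarrow> nat rel \<Rightarrow> nat \<Rightarrow> (nat \<Rightarrow> nat) set" where
  "order_maps A r n =
     {f \<in> A \<rightarrow>\<^sub>E {1..n}. \<forall>a\<in>A. \<forall>b\<in>A. (a, b) \<in> r \<and> a \<noteq> b \<longrightarrow> f a \<le> f b}"

text \<open>\<open>A\<close> is the underlying finite set of the poset and \<open>r\<close> its (reflexive) order relation.\<close>

definition order_polynomial :: "nat set \<Rightarrow> nat rel \<Rightarrow> rat poly" where
  "order_polynomial A r = (THE p. \<forall>n\<ge>1. poly p (of_nat n) = of_nat (card (order_maps A r n)))"

text \<open>Edges point away from the roots, so \<open>u\<close> lies on the path from the root \<open>r\<close> of the component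
  of \<open>v\<close> to \<open>v\<close> iff there are directed walks from \<open>r\<close> to \<open>u\<close> and from \<open>u\<close> to \<open>v\<close>.\<close>

definition forest_order :: "rgraph \<Rightarrow> nat rel" where
  "forest_order F = {(u, v). u \<in> verts F \<and> v \<in> verts F \<and>
     (u = v \<or> (\<exists>r\<in>roots F. (r, u) \<in> (edges F)\<^sup>* \<and> (u, v) \<in> (edges F)\<^sup>*))}"

definition Omega :: "rgraph \<Rightarrow> rat poly" where
  "Omega F = order_polynomial (verts F) (forest_order F)"

definition varphi :: "rgraph \<Rightarrow> rat" where
  "varphi F = poly (pderiv (Omega F)) 0"


section \<open>Cuts and the constants theta\<close>

definition delete_edge :: "rgraph \<Rightarrow> nat \<times> nat \<Rightarrow> rgraph" where
  "delete_edge T e = T\<lparr>edges := edges T - {e}\<rparr>"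

definition reachable_part :: "rgraph \<Rightarrow> nat \<Rightarrow> rgraph" where
  "reachable_part G v = (let W = {w \<in> verts G. (v, w) \<in> (edges G)\<^sup>*} in
     \<lparr>verts = W, edges = edges G \<inter> W \<times> W\<rparr>)"

text \<open>Deleting \<open>e\<close> from a tree leaves two rooted components, with roots \<open>the_root T\<close> and \<open>snd e\<close>;
  each consists of what is reachable from its root.\<close>

definition cut_R :: "rgraph \<Rightarrow> nat \<times> nat \<Rightarrow> rgraph" where
  "cut_R T e = reachable_part (delete_edge T e) (the_root T)"

definition cut_P :: "rgraph \<Rightarrow> nat \<times> nat \<Rightarrow> rgraph" where
  "cut_P T e = reachable_part (delete_edge T e) (snd e)"

text \<open>Edge sequences of length \<open>k\<close> with \<open>e\<^sub>i \<succ> e\<^sub>j\<close> for all \<open>i < j\<close>, where \<open>e \<succ> e'\<close> means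
  that \<open>e'\<close> is an edge of \<open>cut_R T e\<close> (in particular \<open>e' \<noteq> e\<close>).\<close>

definition cut_sequences :: "rgraph \<Rightarrow> nat \<Rightarrow> (nat \<times> nat) list set" where
  "cut_sequences T k = {es. length es = k \<and> set es \<subseteq> edges T \<and>
     sorted_wrt (\<lambda>e e'. e' \<in> edges (cut_R T e)) es}"

text \<open>\<open>pieces T [e\<^sub>1, \<dots>, e\<^sub>m\<^sub>-\<^sub>1]\<close> lists the trees with indices \<open>1, \<dots>, m\<close>; the first
  argument runs through \<open>S\<^sub>0 = T, S\<^sub>1, \<dots>, S\<^sub>m\<^sub>-\<^sub>1\<close>.\<close>

fun pieces :: "rgraph \<Rightarrow> (nat \<times> nat) list \<Rightarrow> rgraph list" where
  "pieces S [] = [S]"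
| "pieces S (e # es) = B_plus (cut_P S e) # pieces (cut_R S e) es"

text \<open>
  The defining equations of \<open>\<theta>\<close>. The last branch is the case of a root with exactly one child and at
  least three vertices. The sum over \<open>m\<close> stops at the number of vertices because there are
  no longer cut sequences (see \<open>cut_sequences_empty\<close> below). Note that the equations are
  not literally a recursion on the size of \<open>T\<close>: cutting the edge at the root yields the
  product \<open>\<theta> T' * \<theta> one_vertex = 0\<close> with \<open>T' \<cong> T\<close>. That they nevertheless determine \<open>\<theta>\<close>
  is \<open>theta_spec_ex1\<close> below. The value \<open>0\<close> on graphs that are not rooted trees is a mere convention.
\<close>

definition theta_spec :: "(rgraph \<Rightarrow> rat) \<Rightarrow> bool" where
  "theta_spec \<theta> \<longleftrightarrow> (\<forall>T. \<theta> T =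
     (if \<not> rooted_tree T then 0
      else if T \<cong> one_vertex \<or> card (children T (the_root T)) > 1 then 0
      else if T \<cong> B_plus one_vertex then 1
      else 1 - (\<Sum>m = 2..card (verts T).
                  1 / fact m * (\<Sum>es\<in>cut_sequences T (m - 1). prod_list (map \<theta> (pieces T es))))))"

definition theta :: "rgraph \<Rightarrow> rat" where
  "theta = (THE \<theta>. theta_spec \<theta>)"


section \<open>Well-definedness of the order polynomial\<close>

lemma poly_gchoose:
  "\<exists>p :: rat poly. \<forall>x. poly p x = x gchoose k"
proof
  show "\<forall>x. poly (smult (1 / fact k) (\<Prod>i = 0..<k. [:- of_nat i, 1:])) x = (x :: rat) gchoose k"
    by (simp add: gbinomial_prod_rev poly_prod)
qed

lemma card_order_maps_image:
  assumes "B \<subseteq> {1..n}" "card B = k" "finite A"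
  shows "card {f \<in> order_maps A r n. f ` A = B} = card {f \<in> order_maps A r k. f ` A = {1..k}}"
proof -
  have "finite B" using assms(1) finite_subset by blast
  then obtain h where h: "bij_betw h {1..k} B" "strict_mono_on {1..k} h"
  proof -
    let ?xs = "sorted_list_of_set B"
    let ?h = "\<lambda>i. ?xs ! (i - 1)"
    have len: "length ?xs = k" using assms(2) \<open>finite B\<close> by simp
    have sm: "strict_mono_on {1..k} ?h"
      by (intro strict_mono_onI)
        (use len sorted_wrt_nth_less[OF strict_sorted_list_of_set[of B]] in auto)
    have "?h ` {1..k} = set ?xs"
    proof
      show "?h ` {1..k} \<subseteq> set ?xs" using len by fastforce
      show "set ?xs \<subseteq> ?h ` {1..k}"
      proof
        fix x assume "x \<in> set ?xs"
        then obtain i where "i < k" "x = ?xs ! i" using len by (metis in_set_conv_nth)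
        then have "x = ?h (Suc i)" "Suc i \<in> {1..k}" by auto
        then show "x \<in> ?h ` {1..k}" by blast
      qed
    qed
    then have "bij_betw ?h {1..k} B"
      using strict_mono_on_imp_inj_on[OF sm] \<open>finite B\<close> by (simp add: bij_betw_def)
    with sm that show ?thesis by blast
  qed
  have le: "h x \<le> h y \<longleftrightarrow> x \<le> y" if "x \<in> {1..k}" "y \<in> {1..k}" for x y
    using h(2) that by (metis leD le_neq_implies_less nat_le_linear order_refl strict_mono_onD)
  let ?g = "\<lambda>f. restrict (h \<circ> f) A"
  have "bij_betw ?g {f \<in> order_maps A r k. f ` A = {1..k}} {f \<in> order_maps A r n. f ` A = B}"
    unfolding bij_betw_def
  proof
    show "inj_on ?g {f \<in> order_maps A r k. f ` A = {1..k}}"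
    proof (rule inj_onI)
      fix f f' assume f: "f \<in> {f \<in> order_maps A r k. f ` A = {1..k}}"
        and f': "f' \<in> {f \<in> order_maps A r k. f ` A = {1..k}}" and eq: "?g f = ?g f'"
      show "f = f'"
      proof
        fix a show "f a = f' a"
        proof (cases "a \<in> A")
          case True
          then have "h (f a) = h (f' a)" using fun_cong[OF eq, of a] by simp
          then show ?thesis using True f f' h(1) by (auto simp: bij_betw_def inj_on_def)
        next
          case False
          then show ?thesis using f f' by (auto simp: order_maps_def PiE_def extensional_def)
        qed
      qed
    qed
    show "?g ` {f \<in> order_maps A r k. f ` A = {1..k}} = {f \<in> order_maps A r n. f ` A = B}"
    proof (intro equalityI subsetI)
      fix g assume "g \<in> ?g ` {f \<in> order_maps A r k. f ` A = {1..k}}"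
      then obtain f where f: "f \<in> order_maps A r k" "f ` A = {1..k}" "g = ?g f" by blast
      have "g ` A = h ` f ` A" by (subst f(3)) auto
      then have im: "g ` A = B" using f(2) h(1) by (simp add: bij_betw_def)
      have "g \<in> A \<rightarrow>\<^sub>E {1..n}" using im assms(1) f(3) by auto
      moreover have "g a \<le> g b" if ab: "a \<in> A" "b \<in> A" "(a, b) \<in> r \<and> a \<noteq> b" for a b
      proof -
        have "f a \<le> f b" using f(1) ab by (simp add: order_maps_def)
        moreover have "f a \<in> {1..k}" "f b \<in> {1..k}" using f(2) ab by blast+
        ultimately have "h (f a) \<le> h (f b)" using le by blast
        moreover have "g a = h (f a)" "g b = h (f b)"
          by (subst f(3), simp add: ab)+
        ultimately show ?thesis by simp
      qed
      ultimately show "g \<in> {f \<in> order_maps A r n. f ` A = B}"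
        using im by (simp add: order_maps_def)
    next
      fix g assume g: "g \<in> {f \<in> order_maps A r n. f ` A = B}"
      let ?i = "the_inv_into {1..k} h"
      let ?f = "restrict (?i \<circ> g) A"
      have ibij: "bij_betw ?i B {1..k}" by (rule bij_betw_the_inv_into[OF h(1)])
      have i1: "?i y \<in> {1..k}" if "y \<in> B" for y
        using ibij that by (rule bij_betwE[THEN bspec])
      have i2: "h (?i y) = y" if "y \<in> B" for y
        by (rule f_the_inv_into_f_bij_betw[OF h(1)]) (use that in simp)
      have gA: "g ` A = B" and gB: "a \<in> A \<Longrightarrow> g a \<in> B" for a using g by auto
      have "?f ` A = ?i ` g ` A" by auto
      then have im: "?f ` A = {1..k}" using gA ibij by (simp add: bij_betw_def)
      have "?f a \<le> ?f b" if ab: "a \<in> A" "b \<in> A" "(a, b) \<in> r \<and> a \<noteq> b" for a b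
      proof -
        have "g a \<le> g b" using g ab by (simp add: order_maps_def)
        then have "h (?i (g a)) \<le> h (?i (g b))" using i2 gB ab by simp
        then have "?i (g a) \<le> ?i (g b)" using le[OF i1 i1] gB ab by blast
        then show ?thesis using ab by simp
      qed
      moreover have "?f \<in> A \<rightarrow>\<^sub>E {1..k}"
        by (rule PiE_I) (use i1 gB in auto)
      ultimately have "?f \<in> {f \<in> order_maps A r k. f ` A = {1..k}}"
        using im by (simp add: order_maps_def)
      moreover have "g = ?g ?f"
      proof
        fix a show "g a = ?g ?f a"
        proof (cases "a \<in> A")
          case True
          then show ?thesis using i2 gB by simp
        next
          case False
          then show ?thesis using g by (auto simp: order_maps_def PiE_def extensional_def)
        qed
      qed
      ultimately show "g \<in> ?g ` {f \<in> order_maps A r k. f ` A = {1..k}}" by (rule rev_image_eqI[of "?f" _ g "?g"])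
    qed
  qed
  from bij_betw_same_card[OF this] show ?thesis by (rule sym)
qed

lemma card_order_maps_eq:
  assumes "finite A"
  shows "card (order_maps A r n) =
    (\<Sum>k\<le>card A. (n choose k) * card {f \<in> order_maps A r k. f ` A = {1..k}})"
proof -
  let ?c = "\<lambda>k. card {f \<in> order_maps A r k. f ` A = {1..k}}"
  have fin: "finite (order_maps A r n)"
    unfolding order_maps_def
    by (rule finite_subset[of _ "A \<rightarrow>\<^sub>E {1..n}"]) (auto intro: finite_PiE assms)
  have zero: "?c k = 0" if "k > card A" for k
  proof -
    have "f ` A \<noteq> {1..k}" for f :: "nat \<Rightarrow> nat"
      using card_image_le[OF assms, of f] that by (metis card_atLeastAtMost diff_Suc_1 leD)
    then show ?thesis by simp
  qed
  have "card (order_maps A r n) = (\<Sum>B\<in>Pow {1..n}. card {f \<in> order_maps A r n. f ` A = B})"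
  proof -
    have "order_maps A r n = (\<Union>B\<in>Pow {1..n}. {f \<in> order_maps A r n. f ` A = B})"
      by (auto simp: order_maps_def)
    also have "card \<dots> = (\<Sum>B\<in>Pow {1..n}. card {f \<in> order_maps A r n. f ` A = B})"
      by (rule card_UN_disjoint) (use fin in auto)
    finally show ?thesis .
  qed
  also have "\<dots> = (\<Sum>B\<in>Pow {1..n}. ?c (card B))"
    by (intro sum.cong refl card_order_maps_image) (use assms in auto)
  also have "\<dots> = (\<Sum>k\<le>n. \<Sum>B\<in>{B \<in> Pow {1..n}. card B = k}. ?c (card B))"
  proof (rule sum.group[symmetric])
    show "card ` Pow {1..n} \<subseteq> {..n}"
    proof
      fix x assume "x \<in> card ` Pow {1..n}"
      then obtain B where "B \<subseteq> {1..n}" "x = card B" by blast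
      then show "x \<in> {..n}" using card_mono[of "{1..n}" B] by simp
    qed
  qed simp_all
  also have "\<dots> = (\<Sum>k\<le>n. (n choose k) * ?c k)"
  proof (intro sum.cong refl)
    fix k
    have "(\<Sum>B\<in>{B \<in> Pow {1..n}. card B = k}. ?c (card B)) = (\<Sum>B\<in>{B \<in> Pow {1..n}. card B = k}. ?c k)"
      by (rule sum.cong) simp_all
    also have "\<dots> = (n choose k) * ?c k"
      using n_subsets[of "{1..n}" k] by simp
    finally show "(\<Sum>B\<in>{B \<in> Pow {1..n}. card B = k}. ?c (card B)) = (n choose k) * ?c k" .
  qed
  also have "\<dots> = (\<Sum>k\<le>max n (card A). (n choose k) * ?c k)"
    by (rule sum.mono_neutral_left) auto
  also have "\<dots> = (\<Sum>k\<le>card A. (n choose k) * ?c k)"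
    by (rule sum.mono_neutral_right) (use zero in auto)
  finally show ?thesis .
qed

lemma order_polynomial_ex1:
  assumes "finite A"
  shows "\<exists>!p :: rat poly. \<forall>n\<ge>1. poly p (of_nat n) = of_nat (card (order_maps A r n))"
proof (rule ex_ex1I)
  obtain g where g: "\<And>k (x :: rat). poly (g k) x = x gchoose k" using poly_gchoose by metis
  let ?c = "\<lambda>k. card {f \<in> order_maps A r k. f ` A = {1..k}}"
  let ?p = "\<Sum>k\<le>card A. smult (of_nat (?c k)) (g k)"
  have "poly ?p (of_nat n) = of_nat (card (order_maps A r n))" for n
    unfolding card_order_maps_eq[OF assms]
    by (simp add: poly_sum g binomial_gbinomial mult.commute)
  then show "\<exists>p :: rat poly. \<forall>n\<ge>1. poly p (of_nat n) = of_nat (card (order_maps A r n))" by blast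
next
  fix p q :: "rat poly"
  assume p: "\<forall>n\<ge>1. poly p (of_nat n) = of_nat (card (order_maps A r n))"
    and q: "\<forall>n\<ge>1. poly q (of_nat n) = of_nat (card (order_maps A r n))"
  have "of_nat ` {1..} \<subseteq> {x :: rat. poly (p - q) x = 0}" using p q by auto
  moreover have "infinite (of_nat ` {1..} :: rat set)"
    by (metis finite_imageD infinite_Ici inj_on_of_nat)
  ultimately have "infinite {x. poly (p - q) x = 0}" using finite_subset by blast
  then show "p = q" using poly_roots_finite[of "p - q"] by auto
qed

lemma poly_order_polynomial:
  assumes "finite A" "n \<ge> 1"
  shows "poly (order_polynomial A r) (of_nat n) = of_nat (card (order_maps A r n))"
  using theI'[OF order_polynomial_ex1[OF assms(1), of r]] assms(2)
  by (simp add: order_polynomial_def)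

lemma varphi_eq_coeff: "varphi F = coeff (Omega F) 1"
  by (simp add: varphi_def poly_0_coeff_0 coeff_pderiv)


section \<open>Basic properties of forests and cuts\<close>

lemma rooted_forest_reachable:
  assumes "rooted_forest F" "v \<in> verts F"
  shows "\<exists>r\<in>roots F. (r, v) \<in> (edges F)\<^sup>*"
proof -
  have "finite (edges F)"
    using assms(1) finite_subset[of "edges F" "verts F \<times> verts F"] by (simp add: rooted_forest_def)
  then have "wf (edges F)"
    using assms(1) by (simp add: rooted_forest_def finite_acyclic_wf)
  then show ?thesis using assms(2)
  proof (induction v rule: wf_induct_rule)
    case (less v)
    show ?case
    proof (cases "v \<in> roots F")
      case False
      then obtain u where u: "(u, v) \<in> edges F" using less.prems by (auto simp: roots_def)
      then have "u \<in> verts F" using assms(1) by (auto simp: rooted_forest_def)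
      then show ?thesis using less.IH[OF u] u by (meson rtrancl.rtrancl_into_rtrancl)
    qed auto
  qed
qed

lemma forest_order_eq:
  assumes "rooted_forest F"
  shows "forest_order F = {(u, v). u \<in> verts F \<and> v \<in> verts F \<and> (u, v) \<in> (edges F)\<^sup>*}"
proof -
  have "\<exists>r\<in>roots F. (r, u) \<in> (edges F)\<^sup>*" if "u \<in> verts F" for u
    using rooted_forest_reachable[OF assms that] .
  then show ?thesis unfolding forest_order_def by blast
qed

lemma partial_order_forest_order:
  assumes "rooted_forest F"
  shows "partial_order_on (verts F) (forest_order F)"
proof -
  have "antisym ((edges F)\<^sup>*)"
    using assms by (simp add: rooted_forest_def acyclic_impl_antisym_rtrancl)
  then show ?thesis unfolding forest_order_eq[OF assms] partial_order_on_def preorder_on_def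
    by (auto simp: refl_on_def antisym_def intro!: transI)
qed

lemma roots_eq_the_root:
  assumes "rooted_tree T"
  shows "roots T = {the_root T}"
proof -
  obtain r where r: "r \<in> roots T" "\<And>y. y \<in> roots T \<Longrightarrow> y = r"
    using assms by (auto simp: rooted_tree_def)
  then have "the_root T = r" unfolding the_root_def by (intro the_equality)
  then show ?thesis using r by blast
qed

lemma root_in_verts: "rooted_tree T \<Longrightarrow> the_root T \<in> verts T"
  using roots_eq_the_root[of T] by (auto simp: roots_def)

lemma no_edge_to_root: "rooted_tree T \<Longrightarrow> (u, the_root T) \<notin> edges T"
  using roots_eq_the_root[of T] by (auto simp: roots_def)

lemma finite_verts: "rooted_tree T \<Longrightarrow> finite (verts T)"
  by (simp add: rooted_tree_def rooted_forest_def)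

lemma parent_unique:
  "rooted_tree T \<Longrightarrow> (u, w) \<in> edges T \<Longrightarrow> (u', w) \<in> edges T \<Longrightarrow> u = u'"
  by (auto simp: rooted_tree_def rooted_forest_def single_valued_def)

lemma rooted_tree_iso_B_plus:
  assumes T: "rooted_tree T"
  shows "\<exists>F. rooted_forest F \<and> T \<cong> B_plus F"
proof -
  let ?r = "the_root T"
  let ?V = "verts T - {?r}"
  define F where "F = \<lparr>verts = ?V, edges = edges T \<inter> ?V \<times> ?V\<rparr>"
  have E: "edges T \<subseteq> verts T \<times> verts T" and fin: "finite (verts T)"
    and ac: "acyclic (edges T)" and sv: "single_valued ((edges T)\<inverse>)"
    using T by (auto simp: rooted_tree_def rooted_forest_def)
  have "acyclic (edges F)" by (rule acyclic_subset[OF ac]) (simp add: F_def)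
  moreover have "single_valued ((edges F)\<inverse>)"
    by (rule single_valued_subset[OF _ sv]) (auto simp: F_def)
  ultimately have F: "rooted_forest F" using fin by (auto simp: rooted_forest_def F_def)
  have into: "v \<noteq> ?r" if "(u, v) \<in> edges T" for u v
    using no_edge_to_root[OF T] that by blast
  have rootsF: "c \<in> roots F \<longleftrightarrow> (?r, c) \<in> edges T" for c
  proof
    assume c: "c \<in> roots F"
    then have "c \<in> verts F" by (simp add: roots_def)
    then have "c \<in> verts T" "c \<notin> roots T" using roots_eq_the_root[OF T] by (auto simp: F_def)
    then obtain u where u: "(u, c) \<in> edges T" by (auto simp: roots_def)
    then have "u = ?r" using c E into[OF u] by (auto simp: roots_def F_def)
    then show "(?r, c) \<in> edges T" using u by simp
  next
    assume c: "(?r, c) \<in> edges T"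
    have "(u, c) \<notin> edges F" for u
    proof
      assume "(u, c) \<in> edges F"
      then have "(u, c) \<in> edges T" "u \<noteq> ?r" by (auto simp: F_def)
      with parent_unique[OF T _ c, of u] show False by blast
    qed
    moreover have "c \<in> verts F" using c E into[OF c] by (auto simp: F_def)
    ultimately show "c \<in> roots F" by (simp add: roots_def)
  qed
  define f where "f w = (if w = ?r then 0 else Suc w)" for w
  have "bij_betw f (verts T) (verts (B_plus F))"
    unfolding bij_betw_def
  proof
    show "inj_on f (verts T)" by (auto simp: inj_on_def f_def split: if_splits)
    show "f ` verts T = verts (B_plus F)"
      using root_in_verts[OF T] by (auto simp: f_def B_plus_def F_def)
  qed
  moreover have "edges (B_plus F) = map_prod f f ` edges T"
  proof (intro equalityI subsetI)
    fix x assume "x \<in> edges (B_plus F)"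
    then consider c where "c \<in> roots F" "x = (0, Suc c)"
      | u v where "(u, v) \<in> edges F" "x = (Suc u, Suc v)"
      by (auto simp: B_plus_def)
    then show "x \<in> map_prod f f ` edges T"
    proof cases
      case 1
      then have c: "(?r, c) \<in> edges T" using rootsF by simp
      then have "x = map_prod f f (?r, c)" using 1 into[OF c] by (simp add: f_def)
      then show ?thesis using c by blast
    next
      case 2
      then have "(u, v) \<in> edges T" "x = map_prod f f (u, v)" by (auto simp: F_def f_def)
      then show ?thesis by blast
    qed
  next
    fix x assume "x \<in> map_prod f f ` edges T"
    then obtain u v where uv: "(u, v) \<in> edges T" "x = (f u, f v)" by auto
    show "x \<in> edges (B_plus F)"
    proof (cases "u = ?r")
      case True
      then have "v \<in> roots F" "x = (0, Suc v)" using uv rootsF into[OF uv(1)] by (auto simp: f_def)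
      then show ?thesis by (simp add: B_plus_def)
    next
      case False
      then have "(u, v) \<in> edges F" "x = map_prod Suc Suc (u, v)"
        using uv into[OF uv(1)] E by (auto simp: F_def f_def)
      then show ?thesis unfolding B_plus_def by auto
    qed
  qed
  ultimately show ?thesis using F unfolding iso_def by blast
qed

lemma verts_cut:
  assumes T: "rooted_tree T" and e: "e \<in> edges T"
  shows "verts (cut_R T e) = {w \<in> verts T. (snd e, w) \<notin> (edges T)\<^sup>*}"
    and "verts (cut_P T e) = {w \<in> verts T. (snd e, w) \<in> (edges T)\<^sup>*}"
proof -
  define u v r where uv: "u = fst e" "v = snd e" "r = the_root T"
  have ev: "e = (u, v)" using uv by simp
  let ?E = "edges T" and ?E' = "edges T - {e}"
  have vr: "v \<noteq> r" using no_edge_to_root[OF T] e ev uv(3) by blast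
  have R: "(v, w) \<notin> ?E\<^sup>*" if "(r, w) \<in> ?E'\<^sup>*" for w
    using that
  proof (induction rule: rtrancl_induct)
    case base
    show ?case using vr no_edge_to_root[OF T] uv(3) by (auto elim: rtranclE)
  next
    case (step y z)
    show ?case
    proof
      assume "(v, z) \<in> ?E\<^sup>*"
      then show False
      proof (cases rule: rtranclE)
        case base
        then have "y = u" using parent_unique[OF T, of y v u] step.hyps(2) e ev by auto
        then show ?thesis using step.hyps(2) base ev by auto
      next
        case (step p)
        then have "p = y" using parent_unique[OF T, of p z y] \<open>(y, z) \<in> ?E'\<close> by auto
        then show ?thesis using step \<open>(v, y) \<notin> ?E\<^sup>*\<close> by blast
      qed
    qed
  qed
  have cover: "(r, w) \<in> ?E'\<^sup>* \<or> (v, w) \<in> ?E'\<^sup>*" if "w \<in> verts T" for w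
  proof -
    have "(r, w) \<in> ?E\<^sup>*"
      using rooted_forest_reachable[of T w] T that roots_eq_the_root[OF T] uv(3)
      by (auto simp: rooted_tree_def)
    then show ?thesis
    proof (induction rule: rtrancl_induct)
      case (step y z)
      show ?case
      proof (cases "(y, z) = e")
        case True
        then show ?thesis using ev by simp
      next
        case False
        then have "(y, z) \<in> ?E'" using step.hyps by simp
        then show ?thesis using step.IH by (meson rtrancl.rtrancl_into_rtrancl)
      qed
    qed simp
  qed
  have mono: "(a, w) \<in> ?E'\<^sup>* \<Longrightarrow> (a, w) \<in> ?E\<^sup>*" for a w
    using rtrancl_mono[of ?E' ?E] by blast
  have "(r, w) \<in> ?E'\<^sup>* \<longleftrightarrow> (v, w) \<notin> ?E\<^sup>*" if "w \<in> verts T" for w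
    using R cover[OF that] mono by blast
  then show "verts (cut_R T e) = {w \<in> verts T. (snd e, w) \<notin> ?E\<^sup>*}"
    by (auto simp: cut_R_def reachable_part_def delete_edge_def uv Let_def)
  have "(v, w) \<in> ?E'\<^sup>* \<longleftrightarrow> (v, w) \<in> ?E\<^sup>*" if "w \<in> verts T" for w
    using R cover[OF that] mono by blast
  then show "verts (cut_P T e) = {w \<in> verts T. (snd e, w) \<in> ?E\<^sup>*}"
    by (auto simp: cut_P_def reachable_part_def delete_edge_def uv Let_def)
qed

lemma edges_cut_R:
  assumes T: "rooted_tree T" and e: "e \<in> edges T"
  shows "edges (cut_R T e) = edges T \<inter> verts (cut_R T e) \<times> verts (cut_R T e)"
proof -
  have "e \<notin> verts (cut_R T e) \<times> verts (cut_R T e)"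
    unfolding verts_cut[OF T e] by (cases e) auto
  then show ?thesis
    by (auto simp: cut_R_def reachable_part_def delete_edge_def Let_def)
qed

lemma rooted_tree_cut_R:
  assumes T: "rooted_tree T" and e: "e \<in> edges T"
  shows "rooted_tree (cut_R T e)"
proof -
  let ?R = "cut_R T e"
  have sub: "edges ?R \<subseteq> edges T" "verts ?R \<subseteq> verts T"
    using edges_cut_R[OF T e] verts_cut[OF T e] by auto
  have "edges ?R \<subseteq> verts ?R \<times> verts ?R" using edges_cut_R[OF T e] by blast
  moreover have "finite (verts ?R)" using finite_subset[OF sub(2) finite_verts[OF T]] .
  moreover have "acyclic (edges ?R)" "single_valued ((edges ?R)\<inverse>)"
    using T sub(1) acyclic_subset[of "edges T" "edges ?R"]
      single_valued_subset[of "(edges ?R)\<inverse>" "(edges T)\<inverse>"]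
    by (auto simp: rooted_tree_def rooted_forest_def)
  ultimately have "rooted_forest ?R" by (simp add: rooted_forest_def)
  moreover have "roots ?R = {the_root T}"
  proof (intro equalityI subsetI)
    fix w assume "w \<in> {the_root T}"
    moreover have "the_root T \<in> verts ?R"
      using root_in_verts[OF T] by (simp add: cut_R_def reachable_part_def delete_edge_def Let_def)
    ultimately show "w \<in> roots ?R"
      using no_edge_to_root[OF T] sub by (auto simp: roots_def)
  next
    fix w assume w: "w \<in> roots ?R"
    then have wR: "w \<in> verts ?R" and no: "\<And>p. (p, w) \<notin> edges ?R" by (auto simp: roots_def)
    have "w = the_root T"
    proof (rule ccontr)
      assume "w \<noteq> the_root T"
      then have "w \<notin> roots T" using roots_eq_the_root[OF T] by simp
      then obtain p where p: "(p, w) \<in> edges T" using wR sub by (auto simp: roots_def)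
      then have "p \<in> verts T" using T by (auto simp: rooted_tree_def rooted_forest_def)
      moreover have "(snd e, p) \<notin> (edges T)\<^sup>*"
        using wR p rtrancl_into_rtrancl[of "snd e" p "edges T" w] unfolding verts_cut(1)[OF T e] by blast
      ultimately have "(p, w) \<in> edges ?R"
        using p wR unfolding edges_cut_R[OF T e] verts_cut(1)[OF T e] by simp
      with no show False by blast
    qed
    then show "w \<in> {the_root T}" by simp
  qed
  ultimately show ?thesis unfolding rooted_tree_def by simp
qed

lemma card_cut:
  assumes T: "rooted_tree T" and e: "e \<in> edges T"
  shows "card (verts (cut_R T e)) + card (verts (cut_P T e)) = card (verts T)"
    and "card (verts (cut_R T e)) > 0" and "card (verts (cut_P T e)) > 0"
    and "finite (verts (cut_P T e))"
proof -
  have "verts T = verts (cut_R T e) \<union> verts (cut_P T e)"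
    "verts (cut_R T e) \<inter> verts (cut_P T e) = {}"
    using verts_cut[OF T e] by auto
  moreover from this show "finite (verts (cut_P T e))" using finite_verts[OF T] by simp
  ultimately show "card (verts (cut_R T e)) + card (verts (cut_P T e)) = card (verts T)"
    using finite_verts[OF T] by (simp add: card_Un_disjoint)
  show "card (verts (cut_R T e)) > 0"
    using root_in_verts[OF rooted_tree_cut_R[OF T e]] finite_verts[OF rooted_tree_cut_R[OF T e]]
    by (auto simp: card_gt_0_iff)
  have "snd e \<in> verts T" using T e by (auto simp: rooted_tree_def rooted_forest_def)
  then have "snd e \<in> verts (cut_P T e)" using verts_cut(2)[OF T e] by simp
  then show "card (verts (cut_P T e)) > 0" using \<open>finite (verts (cut_P T e))\<close>
    by (auto simp: card_gt_0_iff)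
qed

lemma cut_sequences_Cons:
  assumes T: "rooted_tree T" and es: "e # es \<in> cut_sequences T (Suc k)"
  shows "e \<in> edges T" and "es \<in> cut_sequences (cut_R T e) k"
proof -
  show e: "e \<in> edges T" using es by (simp add: cut_sequences_def)
  have tl: "set es \<subseteq> edges (cut_R T e)" "length es = k"
    and sorted: "sorted_wrt (\<lambda>e e'. e' \<in> edges (cut_R T e)) es"
    using es by (auto simp: cut_sequences_def)
  have R: "rooted_tree (cut_R T e)" by (rule rooted_tree_cut_R[OF T e])
  have step: "b \<in> edges (cut_R (cut_R T e) a)"
    if a: "a \<in> set es" and b: "b \<in> set es" and ab: "b \<in> edges (cut_R T a)" for a b
  proof -
    have aR: "a \<in> edges (cut_R T e)" and bR: "b \<in> edges (cut_R T e)" using a b tl by auto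
    have aT: "a \<in> edges T" using aR edges_cut_R[OF T e] by blast
    have mono: "(edges (cut_R T e))\<^sup>* \<subseteq> (edges T)\<^sup>*"
      using edges_cut_R[OF T e] by (intro rtrancl_mono) blast
    have "verts (cut_R T e) \<inter> verts (cut_R T a) \<subseteq> verts (cut_R (cut_R T e) a)"
      unfolding verts_cut(1)[OF R aR] verts_cut(1)[OF T aT] using mono by blast
    moreover have "b \<in> verts (cut_R T e) \<times> verts (cut_R T e)" using bR edges_cut_R[OF T e] by simp
    moreover have "b \<in> verts (cut_R T a) \<times> verts (cut_R T a)" using ab edges_cut_R[OF T aT] by simp
    ultimately have "b \<in> verts (cut_R (cut_R T e) a) \<times> verts (cut_R (cut_R T e) a)"
      by (auto simp: mem_Times_iff)
    then show ?thesis using bR edges_cut_R[OF R aR] by simp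
  qed
  have "sorted_wrt (\<lambda>e' e''. e'' \<in> edges (cut_R (cut_R T e) e')) es"
    by (rule sorted_wrt_mono_rel[OF step sorted])
  then show "es \<in> cut_sequences (cut_R T e) k" using tl by (simp add: cut_sequences_def)
qed

lemma cut_sequences_length:
  assumes "rooted_tree T" "es \<in> cut_sequences T k"
  shows "k < card (verts T)"
  using assms
proof (induction k arbitrary: T es)
  case 0
  then show ?case using root_in_verts[of T] finite_verts[of T] by (auto simp: card_gt_0_iff)
next
  case (Suc k)
  then obtain e es' where es: "es = e # es'" by (cases es) (auto simp: cut_sequences_def)
  have e: "e \<in> edges T" and es': "es' \<in> cut_sequences (cut_R T e) k"
    using cut_sequences_Cons[OF Suc.prems(1) Suc.prems(2)[unfolded es]] by blast+
  have "k < card (verts (cut_R T e))"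
    using Suc.IH[OF rooted_tree_cut_R[OF Suc.prems(1) e] es'] .
  then show ?case using card_cut[OF Suc.prems(1) e] by linarith
qed

lemma cut_sequences_empty:
  "rooted_tree T \<Longrightarrow> card (verts T) \<le> k \<Longrightarrow> cut_sequences T k = {}"
  using cut_sequences_length by fastforce


section \<open>The defining equations determine theta\<close>

lemma card_verts_B_plus: "finite (verts F) \<Longrightarrow> card (verts (B_plus F)) = Suc (card (verts F))"
  by (simp add: B_plus_def card_image)

lemma pieces_small:
  assumes "rooted_tree T" "es \<in> cut_sequences T (Suc k)"
  shows "(\<forall>X\<in>set (pieces T es). card (verts X) < card (verts T)) \<or>
         (\<exists>X\<in>set (pieces T es). rooted_tree X \<and> card (verts X) = 1)"
  using assms
proof (induction k arbitrary: T es)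
  case 0
  then have "length es = 1" by (simp add: cut_sequences_def)
  then obtain e where es: "es = [e]" by (cases es) auto
  have e: "e \<in> edges T" using cut_sequences_Cons(1)[OF 0(1) 0(2)[unfolded es]] .
  show ?case
  proof (cases "card (verts (cut_R T e)) = 1")
    case True
    then show ?thesis using es rooted_tree_cut_R[OF 0(1) e] by simp
  next
    case False
    then have "card (verts (B_plus (cut_P T e))) < card (verts T)"
      "card (verts (cut_R T e)) < card (verts T)"
      using card_cut[OF 0(1) e] card_verts_B_plus[of "cut_P T e"] by linarith+
    then show ?thesis using es by simp
  qed
next
  case (Suc k)
  then obtain e es' where es: "es = e # es'" by (cases es) (auto simp: cut_sequences_def)
  have e: "e \<in> edges T" and es': "es' \<in> cut_sequences (cut_R T e) (Suc k)"
    using cut_sequences_Cons[OF Suc.prems(1) Suc.prems(2)[unfolded es]] by blast+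
  have R: "rooted_tree (cut_R T e)" by (rule rooted_tree_cut_R[OF Suc.prems(1) e])
  have "card (verts (cut_R T e)) > 1" using cut_sequences_length[OF R es'] by simp
  then have less: "card (verts (B_plus (cut_P T e))) < card (verts T)"
    "card (verts (cut_R T e)) < card (verts T)"
    using card_cut[OF Suc.prems(1) e] card_verts_B_plus[of "cut_P T e"] by linarith+
  from Suc.IH[OF R es'] show ?case
  proof
    assume "\<forall>X\<in>set (pieces (cut_R T e) es'). card (verts X) < card (verts (cut_R T e))"
    then have "\<forall>X\<in>set (pieces T es). card (verts X) < card (verts T)"
      using es less by (auto intro: less_trans)
    then show ?thesis by blast
  next
    assume "\<exists>X\<in>set (pieces (cut_R T e) es'). rooted_tree X \<and> card (verts X) = 1"
    then show ?thesis using es by auto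
  qed
qed

lemma rooted_tree_card_1_iso:
  assumes "rooted_tree T" "card (verts T) = 1"
  shows "T \<cong> one_vertex"
proof -
  obtain x where x: "verts T = {x}" using assms(2) by (auto simp: card_1_singleton_iff)
  then have "the_root T = x" using root_in_verts[OF assms(1)] by simp
  moreover have "edges T \<subseteq> {x} \<times> {x}"
    using assms(1) x by (simp add: rooted_tree_def rooted_forest_def)
  ultimately have "edges T = {}" using no_edge_to_root[OF assms(1)] by auto
  then show ?thesis using x unfolding iso_def
    by (intro exI[of _ "\<lambda>_. 0"]) (auto simp: B_plus_def empty_forest_def roots_def bij_betw_def)
qed

text \<open>The recursion on the number of vertices obtained by replacing the factors that are not smaller
  than \<open>T\<close> by \<open>0\<close>.\<close>

function theta_rec :: "rgraph \<Rightarrow> rat" where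
  "theta_rec T =
     (if \<not> rooted_tree T then 0
      else if T \<cong> one_vertex \<or> card (children T (the_root T)) > 1 then 0
      else if T \<cong> B_plus one_vertex then 1
      else 1 - (\<Sum>m = 2..card (verts T).
                  1 / fact m * (\<Sum>es\<in>cut_sequences T (m - 1). prod_list
                    (map (\<lambda>X. if card (verts X) < card (verts T) then theta_rec X else 0)
                      (pieces T es)))))"
  by pat_completeness auto
termination by (relation "measure (\<lambda>T. card (verts T))") simp_all

declare theta_rec.simps [simp del]

lemma prod_list_map_eq_0: "X \<in> set Xs \<Longrightarrow> f X = 0 \<Longrightarrow> prod_list (map f Xs) = (0 :: rat)"
  by (induction Xs) auto

lemma prod_pieces_cong:
  fixes f g :: "rgraph \<Rightarrow> rat"
  assumes T: "rooted_tree T" and es: "es \<in> cut_sequences T (m - 1)" and m: "m \<ge> 2"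
    and eq: "\<And>X. card (verts X) < card (verts T) \<Longrightarrow> f X = g X"
    and f0: "\<And>X. rooted_tree X \<Longrightarrow> card (verts X) = 1 \<Longrightarrow> f X = 0"
    and g0: "\<And>X. rooted_tree X \<Longrightarrow> card (verts X) = 1 \<Longrightarrow> g X = 0"
  shows "prod_list (map f (pieces T es)) = prod_list (map g (pieces T es))"
proof -
  have "es \<in> cut_sequences T (Suc (m - 2))"
    using es m by (simp add: numeral_2_eq_2 Suc_diff_Suc)
  from pieces_small[OF T this] show ?thesis
  proof
    assume "\<forall>X\<in>set (pieces T es). card (verts X) < card (verts T)"
    then show ?thesis using eq by (intro arg_cong[of _ _ prod_list] map_cong) auto
  next
    assume "\<exists>X\<in>set (pieces T es). rooted_tree X \<and> card (verts X) = 1"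
    then obtain X where "X \<in> set (pieces T es)" "rooted_tree X" "card (verts X) = 1" by blast
    then show ?thesis using f0[of X] g0[of X] prod_list_map_eq_0[of X] by metis
  qed
qed

lemma theta_spec_0:
  assumes "theta_spec \<theta>" "rooted_tree X" "card (verts X) = 1"
  shows "\<theta> X = 0"
  using assms(1)[unfolded theta_spec_def, THEN spec, of X] rooted_tree_card_1_iso[OF assms(2,3)]
  by simp

lemma theta_spec_theta_rec: "theta_spec theta_rec"
  unfolding theta_spec_def
proof
  fix T
  have 0: "theta_rec X = 0" if "rooted_tree X" "card (verts X) = 1" for X
    using rooted_tree_card_1_iso[OF that] by (subst theta_rec.simps) simp
  have prod: "prod_list (map (\<lambda>X. if card (verts X) < card (verts T) then theta_rec X else 0) (pieces T es))
      = prod_list (map theta_rec (pieces T es))"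
    if "rooted_tree T" "es \<in> cut_sequences T (m - 1)" "m \<in> {2..card (verts T)}" for es m
    by (rule prod_pieces_cong[of _ _ m]) (use that 0 in auto)
  have sum: "(\<Sum>m = 2..card (verts T). 1 / fact m * (\<Sum>es\<in>cut_sequences T (m - 1). prod_list
        (map (\<lambda>X. if card (verts X) < card (verts T) then theta_rec X else 0) (pieces T es))))
      = (\<Sum>m = 2..card (verts T).
         1 / fact m * (\<Sum>es\<in>cut_sequences T (m - 1). prod_list (map theta_rec (pieces T es))))"
    if "rooted_tree T"
    by (intro sum.cong refl arg_cong2[of _ _ _ _ "(*)"] prod that)
  show "theta_rec T =
     (if \<not> rooted_tree T then 0
      else if T \<cong> one_vertex \<or> card (children T (the_root T)) > 1 then 0
      else if T \<cong> B_plus one_vertex then 1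
      else 1 - (\<Sum>m = 2..card (verts T).
         1 / fact m * (\<Sum>es\<in>cut_sequences T (m - 1). prod_list (map theta_rec (pieces T es)))))"
  proof (cases "rooted_tree T")
    case True
    show ?thesis by (subst theta_rec.simps) (simp only: sum[OF True])
  next
    case False
    then show ?thesis by (subst theta_rec.simps) simp
  qed
qed

lemma theta_spec_ex1: "\<exists>!\<theta>. theta_spec \<theta>"
proof (rule ex_ex1I)
  show "\<exists>\<theta>. theta_spec \<theta>" using theta_spec_theta_rec by blast
next
  fix f g assume f: "theta_spec f" and g: "theta_spec g"
  have "f T = g T" for T
  proof (induction "card (verts T)" arbitrary: T rule: less_induct)
    case less
    have prod: "prod_list (map f (pieces T es)) = prod_list (map g (pieces T es))"
      if "rooted_tree T" "es \<in> cut_sequences T (m - 1)" "m \<in> {2..card (verts T)}" for es m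
      by (rule prod_pieces_cong[of _ _ m])
        (use that less theta_spec_0[OF f] theta_spec_0[OF g] in auto)
    have sum: "(\<Sum>m = 2..card (verts T).
          1 / fact m * (\<Sum>es\<in>cut_sequences T (m - 1). prod_list (map f (pieces T es))))
        = (\<Sum>m = 2..card (verts T).
          1 / fact m * (\<Sum>es\<in>cut_sequences T (m - 1). prod_list (map g (pieces T es))))"
      if "rooted_tree T"
      by (intro sum.cong refl arg_cong2[of _ _ _ _ "(*)"] prod that)
    note fT = f[unfolded theta_spec_def, THEN spec, of T]
      and gT = g[unfolded theta_spec_def, THEN spec, of T]
    show ?case
    proof (cases "rooted_tree T")
      case True
      show ?thesis unfolding fT gT by (simp only: sum[OF True])
    next
      case False
      then show ?thesis using fT gT by simp
    qed
  qed
  then show "f = g" by blast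
qed

lemma theta_spec_theta: "theta_spec theta"
  unfolding theta_def by (rule theI'[OF theta_spec_ex1])

end

theory Submission
  imports Defs
begin

text \<open>
  Splitting an order-preserving map \<open>A \<rightarrow> {1..m + n}\<close> at the value \<open>m\<close> shows that order polynomials
  are of binomial type with respect to cutting a poset along an upper set:
  \<open>\<Omega>(A, s + t) = (\<Sum>U. \<Omega>(A - U, s) * \<Omega>(U, t))\<close>, where \<open>U\<close> runs through the upper sets of \<open>A\<close>.
  The coefficient of \<open>t\<close> is a differential equation, \<open>\<Omega>'(A) = (\<Sum>U. \<phi>(U) * \<Omega>(A - U))\<close>,
  in which \<open>\<phi>\<close> is the linear coefficient of \<open>\<Omega>\<close> (\<open>pderiv_order_polynomial\<close>).

  Let \<open>A\<close> now be the set of vertices of a rooted tree \<open>T\<close> other than its root, that is, the forest \<open>F\<close> if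
  \<open>T = B_+(F)\<close>. As \<open>\<Omega>\<close> is multiplicative on disjoint unions and vanishes at \<open>0\<close> on nonempty
  posets, \<open>\<phi>(U)\<close> is \<open>0\<close> unless \<open>U\<close> is a tree. The upper sets that are trees are exactly the
  branches \<open>P_e(T)\<close>, one for each edge \<open>e\<close>, and what remains of \<open>A\<close> is \<open>R_e(T)\<close> without its root
  (\<open>pderiv_tree_poly\<close>). Iterating the differential equation produces the sequences of successive
  cuts: \<open>(k + 1)!\<close> times the coefficient of \<open>s^(k+1)\<close> in \<open>\<Omega>(F, s)\<close> is the sum over the cut
  sequences of length \<open>k\<close> of the products of the numbers \<open>\<phi>(G)\<close> over the pieces \<open>B_+(G)\<close>
  (\<open>coeff_tree_poly\<close>).
  In other words, \<open>\<Omega>(F, s)\<close> is the convolution exponential of \<open>s * \<phi>\<close>.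

  Since there is exactly one order-preserving map into a one-element chain, \<open>\<Omega>(F, 1) = 1\<close>.
  Summing the coefficients therefore gives the recursion that defines \<open>\<theta>\<close>, with \<open>\<phi>\<close>
  in place of \<open>\<theta>\<close>; the conditions on the degenerate trees hold for \<open>\<phi>\<close> as well, in particular it vanishes
  if the root has several children, because \<open>F\<close> is then not a tree. The recursion has only one solution, so
  \<open>\<theta> = \<phi>\<close>.
\<close>

section \<open>Values of order polynomials\<close>

lemma rat_poly_eqI:
  fixes p q :: "rat poly"
  assumes "\<And>n :: nat. poly p (of_nat n) = poly q (of_nat n)"
  shows "p = q"
proof -
  have "range of_nat \<subseteq> {x :: rat. poly (p - q) x = 0}" using assms by auto
  moreover have "infinite (range of_nat :: rat set)"
    by (metis finite_imageD infinite_UNIV_nat inj_of_nat)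
  ultimately have "infinite {x. poly (p - q) x = 0}" using finite_subset by blast
  then show ?thesis using poly_roots_finite[of "p - q"] by auto
qed

text \<open>
  The counting formula also holds for \<open>n = 0\<close>, because both sides are the same combination of
  binomial coefficients \<open>n choose k\<close>. This is what gives access to the constant coefficient.
\<close>

lemma poly_order_polynomial_nat:
  assumes "finite A"
  shows "poly (order_polynomial A r) (of_nat n) = of_nat (card (order_maps A r n))"
proof -
  obtain g where g: "\<And>k (x :: rat). poly (g k) x = x gchoose k" using poly_gchoose by metis
  let ?c = "\<lambda>k. card {f \<in> order_maps A r k. f ` A = {1..k}}"
  let ?p = "\<Sum>k\<le>card A. smult (of_nat (?c k)) (g k)"
  have p: "poly ?p (of_nat n) = of_nat (card (order_maps A r n))" for n
    unfolding card_order_maps_eq[OF assms]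
    by (simp add: poly_sum g binomial_gbinomial mult.commute)
  then have "order_polynomial A r = ?p"
    unfolding order_polynomial_def by (intro the1_equality order_polynomial_ex1 assms) blast
  then show ?thesis using p by simp
qed

lemma order_maps_empty [simp]: "order_maps {} r n = {\<lambda>_. undefined}"
  by (simp add: order_maps_def)

lemma order_polynomial_empty [simp]: "order_polynomial {} r = 1"
  by (rule rat_poly_eqI) (simp add: poly_order_polynomial_nat)

lemma poly_order_polynomial_0:
  assumes "finite A" "A \<noteq> {}"
  shows "poly (order_polynomial A r) 0 = 0"
proof -
  have "order_maps A r 0 = {}" using assms by (auto simp: order_maps_def PiE_eq_empty_iff)
  then show ?thesis using poly_order_polynomial_nat[OF assms(1), of r 0] by simp
qed

lemma poly_order_polynomial_1:
  assumes "finite A"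
  shows "poly (order_polynomial A r) 1 = 1"
proof -
  have "order_maps A r 1 = {\<lambda>a\<in>A. 1}"
    by (auto simp: order_maps_def PiE_iff restrict_def extensional_def fun_eq_iff)
  then show ?thesis using poly_order_polynomial_nat[OF assms, of r 1] by simp
qed

lemma order_polynomial_singleton: "order_polynomial {a} r = [:0, 1:]"
proof (rule rat_poly_eqI)
  fix n
  have "order_maps {a} r n = {a} \<rightarrow>\<^sub>E {1..n}" by (auto simp: order_maps_def)
  then show "poly (order_polynomial {a} r) (of_nat n) = poly [:0, 1:] (of_nat n)"
    by (simp add: poly_order_polynomial_nat card_PiE)
qed

text \<open>
  Invariance under isomorphism. The case \<open>h = id\<close> allows replacing the relation by another one that agrees with
  it on \<open>A\<close>, for instance reachability in a subtree by reachability in the whole tree.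
\<close>

lemma order_polynomial_image:
  assumes "finite A" "inj_on h A"
    and rel: "\<And>a b. a \<in> A \<Longrightarrow> b \<in> A \<Longrightarrow> (h a, h b) \<in> r' \<longleftrightarrow> (a, b) \<in> r"
  shows "order_polynomial (h ` A) r' = order_polynomial A r"
proof (rule rat_poly_eqI)
  fix n
  let ?i = "the_inv_into A h"
  have i: "?i (h a) = a" if "a \<in> A" for a using the_inv_into_f_f[OF assms(2) that] .
  have "bij_betw (\<lambda>f. restrict (f \<circ> h) A) (order_maps (h ` A) r' n) (order_maps A r n)"
  proof (rule bij_betw_byWitness[where f' = "\<lambda>f. restrict (f \<circ> ?i) (h ` A)"])
    show "\<forall>f\<in>order_maps (h ` A) r' n. restrict (restrict (f \<circ> h) A \<circ> ?i) (h ` A) = f"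
      using i by (auto simp: order_maps_def PiE_iff fun_eq_iff extensional_def)
    show "\<forall>f\<in>order_maps A r n. restrict (restrict (f \<circ> ?i) (h ` A) \<circ> h) A = f"
      using i by (auto simp: order_maps_def PiE_iff fun_eq_iff extensional_def)
    show "(\<lambda>f. restrict (f \<circ> h) A) ` order_maps (h ` A) r' n \<subseteq> order_maps A r n"
    proof (rule image_subsetI)
      fix f assume f: "f \<in> order_maps (h ` A) r' n"
      have "f (h a) \<le> f (h b)" if "a \<in> A" "b \<in> A" "(a, b) \<in> r" "a \<noteq> b" for a b
        using that f rel inj_on_eq_iff[OF assms(2)] by (simp add: order_maps_def)
      then show "restrict (f \<circ> h) A \<in> order_maps A r n"
        using f by (auto simp: order_maps_def PiE_iff)
    qed
    show "(\<lambda>f. restrict (f \<circ> ?i) (h ` A)) ` order_maps A r n \<subseteq> order_maps (h ` A) r' n"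
    proof (rule image_subsetI)
      fix f assume f: "f \<in> order_maps A r n"
      have "f (?i x) \<le> f (?i y)" if "x \<in> h ` A" "y \<in> h ` A" "(x, y) \<in> r'" "x \<noteq> y" for x y
      proof -
        obtain a b where "a \<in> A" "b \<in> A" "x = h a" "y = h b" using \<open>x \<in> h ` A\<close> \<open>y \<in> h ` A\<close> by blast
        moreover from this have "(a, b) \<in> r" "a \<noteq> b" using that(3,4) rel by auto
        ultimately show ?thesis using f i by (simp add: order_maps_def)
      qed
      moreover have "restrict (f \<circ> ?i) (h ` A) \<in> h ` A \<rightarrow>\<^sub>E {1..n}"
        using f i by (auto simp: order_maps_def PiE_iff)
      ultimately show "restrict (f \<circ> ?i) (h ` A) \<in> order_maps (h ` A) r' n"
        by (simp add: order_maps_def)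
    qed
  qed
  then show "poly (order_polynomial (h ` A) r') (of_nat n) = poly (order_polynomial A r) (of_nat n)"
    using assms(1) by (simp add: poly_order_polynomial_nat bij_betw_same_card)
qed

section \<open>Cutting along upper sets\<close>

lemma order_polynomial_disjoint_Un:
  assumes "finite A" "finite B" "A \<inter> B = {}"
    and "\<And>a b. a \<in> A \<Longrightarrow> b \<in> B \<Longrightarrow> (a, b) \<notin> r \<and> (b, a) \<notin> r"
  shows "order_polynomial (A \<union> B) r = order_polynomial A r * order_polynomial B r"
proof (rule rat_poly_eqI)
  fix n
  have "bij_betw (\<lambda>f. (restrict f A, restrict f B)) (order_maps (A \<union> B) r n)
    (order_maps A r n \<times> order_maps B r n)"
  proof (rule bij_betw_byWitness[where f' = "\<lambda>(f, g). \<lambda>a. if a \<in> A then f a else g a"])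
    show "\<forall>f\<in>order_maps (A \<union> B) r n.
        (\<lambda>(f, g). \<lambda>a. if a \<in> A then f a else g a) (restrict f A, restrict f B) = f"
      by (auto simp: order_maps_def PiE_iff fun_eq_iff extensional_def)
    show "\<forall>p\<in>order_maps A r n \<times> order_maps B r n.
        (\<lambda>f. (restrict f A, restrict f B)) ((\<lambda>(f, g). \<lambda>a. if a \<in> A then f a else g a) p) = p"
      using assms(3) by (auto simp: order_maps_def PiE_iff fun_eq_iff extensional_def)
    show "(\<lambda>f. (restrict f A, restrict f B)) ` order_maps (A \<union> B) r n
        \<subseteq> order_maps A r n \<times> order_maps B r n"
      by (auto simp: order_maps_def PiE_iff)
    show "(\<lambda>(f, g). \<lambda>a. if a \<in> A then f a else g a) ` (order_maps A r n \<times> order_maps B r n)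
        \<subseteq> order_maps (A \<union> B) r n"
      using assms(3,4) by (auto simp: order_maps_def PiE_iff extensional_def)
  qed
  from bij_betw_same_card[OF this]
  show "poly (order_polynomial (A \<union> B) r) (of_nat n)
      = poly (order_polynomial A r * order_polynomial B r) (of_nat n)"
    using assms(1,2) by (simp add: poly_order_polynomial_nat card_cartesian_product)
qed

definition upsets :: "'a set \<Rightarrow> 'a rel \<Rightarrow> 'a set set" where
  "upsets A r = {U. U \<subseteq> A \<and> (\<forall>a\<in>U. \<forall>b\<in>A. (a, b) \<in> r \<longrightarrow> b \<in> U)}"

text \<open>
  Outside \<open>U\<close> the map takes values up to \<open>m\<close>; on \<open>U\<close>, subtracting \<open>m\<close> makes it a map into \<open>{1..n}\<close>.
  Conversely two such maps can be glued, since no element of the upper set \<open>U\<close> lies below an element outside \<open>U\<close>.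
\<close>

lemma card_order_maps_upset:
  assumes "U \<in> upsets A r"
  shows "card {f \<in> order_maps A r (m + n). {a \<in> A. m < f a} = U}
    = card (order_maps (A - U) r m) * card (order_maps U r n)"
proof -
  have U: "U \<subseteq> A" "\<And>a b. a \<in> U \<Longrightarrow> b \<in> A \<Longrightarrow> (a, b) \<in> r \<Longrightarrow> b \<in> U"
    using assms by (auto simp: upsets_def)
  let ?split = "\<lambda>f. (restrict f (A - U), restrict (\<lambda>a. f a - m) U)"
  let ?glue = "\<lambda>(g, h). \<lambda>a. if a \<in> U then h a + m else g a"
  have "bij_betw ?split {f \<in> order_maps A r (m + n). {a \<in> A. m < f a} = U}
    (order_maps (A - U) r m \<times> order_maps U r n)"
  proof (rule bij_betw_byWitness[where f' = ?glue])
    show "\<forall>f\<in>{f \<in> order_maps A r (m + n). {a \<in> A. m < f a} = U}. ?glue (?split f) = f"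
      by (auto simp: order_maps_def PiE_iff fun_eq_iff extensional_def)
    show "\<forall>p\<in>order_maps (A - U) r m \<times> order_maps U r n. ?split (?glue p) = p"
      by (auto simp: order_maps_def PiE_iff fun_eq_iff extensional_def)
    show "?split ` {f \<in> order_maps A r (m + n). {a \<in> A. m < f a} = U}
        \<subseteq> order_maps (A - U) r m \<times> order_maps U r n"
    proof (rule image_subsetI)
      fix f assume "f \<in> {f \<in> order_maps A r (m + n). {a \<in> A. m < f a} = U}"
      then have f: "f \<in> order_maps A r (m + n)" and fU: "U = {a \<in> A. m < f a}" by auto
      have "restrict f (A - U) \<in> order_maps (A - U) r m"
        using f by (auto simp: order_maps_def PiE_iff fU not_less)
      moreover have "restrict (\<lambda>a. f a - m) U \<in> order_maps U r n"
        using f by (auto simp: order_maps_def PiE_iff fU Suc_le_eq diff_le_mono)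
      ultimately show "?split f \<in> order_maps (A - U) r m \<times> order_maps U r n" by simp
    qed
    show "?glue ` (order_maps (A - U) r m \<times> order_maps U r n)
        \<subseteq> {f \<in> order_maps A r (m + n). {a \<in> A. m < f a} = U}"
    proof (rule image_subsetI, clarify)
      fix g h assume g: "g \<in> order_maps (A - U) r m" and h: "h \<in> order_maps U r n"
      have g1: "1 \<le> g a" "g a \<le> m" if "a \<in> A" "a \<notin> U" for a
        using g that by (auto simp: order_maps_def PiE_iff)
      have h1: "1 \<le> h a" "h a \<le> n" if "a \<in> U" for a
        using h that by (auto simp: order_maps_def PiE_iff)
      let ?f = "\<lambda>a. if a \<in> U then h a + m else g a"
      have "?f \<in> A \<rightarrow>\<^sub>E {1..m + n}"
        using g h U(1) g1 h1 by (fastforce simp: order_maps_def PiE_iff extensional_def)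
      moreover have "?f a \<le> ?f b" if "a \<in> A" "b \<in> A" "(a, b) \<in> r" "a \<noteq> b" for a b
        using that g h U(2)[of a b] g1(2)[of a] by (auto simp: order_maps_def)
      moreover have "m < ?f a \<longleftrightarrow> a \<in> U" if "a \<in> A" for a
        using g1(2)[of a] h1(1)[of a] that by auto
      then have "{a \<in> A. m < ?f a} = U" using U(1) by blast
      ultimately show "?f \<in> order_maps A r (m + n) \<and> {a \<in> A. m < ?f a} = U"
        by (simp add: order_maps_def)
    qed
  qed
  from bij_betw_same_card[OF this] show ?thesis by (simp add: card_cartesian_product)
qed

lemma finite_upsets: "finite A \<Longrightarrow> finite (upsets A r)"
  by (rule finite_subset[of _ "Pow A"]) (auto simp: upsets_def)

lemma finite_order_maps: "finite A \<Longrightarrow> finite (order_maps A r n)"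
  unfolding order_maps_def by (rule finite_subset[of _ "A \<rightarrow>\<^sub>E {1..n}"]) (auto intro: finite_PiE)

lemma card_order_maps_add:
  assumes "finite A"
  shows "card (order_maps A r (m + n))
    = (\<Sum>U\<in>upsets A r. card (order_maps (A - U) r m) * card (order_maps U r n))"
proof -
  let ?S = "\<lambda>U. {f \<in> order_maps A r (m + n). {a \<in> A. m < f a} = U}"
  have "{a \<in> A. m < f a} \<in> upsets A r" if "f \<in> order_maps A r (m + n)" for f
    using that by (auto simp: upsets_def order_maps_def) (metis less_le_trans)
  then have "order_maps A r (m + n) = (\<Union>U\<in>upsets A r. ?S U)" by blast
  also have "card \<dots> = (\<Sum>U\<in>upsets A r. card (?S U))"
    by (rule card_UN_disjoint) (use assms finite_upsets finite_order_maps in auto)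
  also have "\<dots> = (\<Sum>U\<in>upsets A r. card (order_maps (A - U) r m) * card (order_maps U r n))"
    by (intro sum.cong refl card_order_maps_upset)
  finally show ?thesis .
qed

text \<open>
  The coefficient of \<open>t\<close> in \<open>\<Omega>(A, m + t) = (\<Sum>U. \<Omega>(A - U, m) * \<Omega>(U, t))\<close>. Fixing the natural number
  \<open>m\<close> turns both sides into polynomials in the single variable \<open>t\<close>.
\<close>

lemma pderiv_order_polynomial:
  assumes "finite A"
  shows "pderiv (order_polynomial A r)
    = (\<Sum>U\<in>upsets A r. smult (coeff (order_polynomial U r) 1) (order_polynomial (A - U) r))"
proof (rule rat_poly_eqI)
  fix m :: nat
  have fin: "finite U" if "U \<in> upsets A r" for U
    using that assms finite_subset by (auto simp: upsets_def)
  \<comment> \<open>Composition with \<open>[:m, 1:]\<close> is the substitution of \<open>m + t\<close>.\<close>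
  have "pcompose (order_polynomial A r) [:of_nat m, 1:]
    = (\<Sum>U\<in>upsets A r. smult (poly (order_polynomial (A - U) r) (of_nat m)) (order_polynomial U r))"
    (is "?l = ?r")
  proof (rule rat_poly_eqI)
    fix n :: nat
    have "poly ?l (of_nat n) = of_nat (card (order_maps A r (m + n)))"
      using poly_order_polynomial_nat[OF assms, of r "m + n"] by (simp add: poly_pcompose)
    also have "\<dots> = poly ?r (of_nat n)"
      using assms fin by (simp add: card_order_maps_add poly_sum poly_order_polynomial_nat)
    finally show "poly ?l (of_nat n) = poly ?r (of_nat n)" .
  qed
  then have "coeff (pderiv ?l) 0 = coeff (pderiv ?r) 0" by simp
  moreover have "coeff (pderiv ?l) 0 = poly (pderiv (order_polynomial A r)) (of_nat m)"
    by (simp add: pderiv_pcompose pderiv_pCons poly_pcompose flip: poly_0_coeff_0)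
  moreover have "coeff (pderiv ?r) 0 = poly (\<Sum>U\<in>upsets A r.
      smult (coeff (order_polynomial U r) 1) (order_polynomial (A - U) r)) (of_nat m)"
    by (simp add: coeff_pderiv coeff_sum poly_sum mult.commute)
  ultimately show "poly (pderiv (order_polynomial A r)) (of_nat m) = poly (\<Sum>U\<in>upsets A r.
      smult (coeff (order_polynomial U r) 1) (order_polynomial (A - U) r)) (of_nat m)" by simp
qed


section \<open>Forest orders\<close>

text \<open>
  In a forest order the elements above a minimal element \<open>v\<close> of \<open>U\<close> are unrelated to the rest of \<open>U\<close>: a common
  upper bound of \<open>v\<close> and of some \<open>b\<close> forces \<open>v\<close> and \<open>b\<close> to be comparable. If \<open>U\<close> is not the set of
  elements above \<open>v\<close>, then \<open>\<Omega>(U)\<close> is a product of two polynomials without constant coefficient.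
\<close>

lemma coeff_1_order_polynomial_not_principal:
  assumes "finite A" and U: "U \<in> upsets A r"
    and r: "refl r" "trans r" "antisym r"
    and forest: "\<And>u v w. (u, w) \<in> r \<Longrightarrow> (v, w) \<in> r \<Longrightarrow> (u, v) \<in> r \<or> (v, u) \<in> r"
    and not_principal: "\<And>v. v \<in> A \<Longrightarrow> U \<noteq> {w \<in> A. (v, w) \<in> r}"
  shows "coeff (order_polynomial U r) 1 = 0"
proof (cases "U = {}")
  case False
  have fin: "finite U" and UA: "U \<subseteq> A"
    using U assms(1) finite_subset by (auto simp: upsets_def)
  have "wf ((r - Id) \<inter> U \<times> U)"
  proof (rule finite_acyclic_wf)
    show "finite ((r - Id) \<inter> U \<times> U)" using fin by blast
    have "trans (r - Id)" using r(2,3) by (rule trans_diff_Id)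
    then have "acyclic (r - Id)" by (simp add: acyclic_irrefl irrefl_def)
    then show "acyclic ((r - Id) \<inter> U \<times> U)" by (rule acyclic_subset) blast
  qed
  then obtain v where v: "v \<in> U" and min: "\<And>w. w \<in> U \<Longrightarrow> (w, v) \<in> r \<Longrightarrow> w = v"
    using False by (elim wfE_min') auto
  let ?V = "{w \<in> A. (v, w) \<in> r}"
  have VU: "?V \<subseteq> U" using U v by (auto simp: upsets_def)
  have "v \<in> ?V" using v UA r(1) by (auto simp: refl_on_def)
  have rest: "U - ?V \<noteq> {}" using not_principal[of v] v UA VU by blast
  have "order_polynomial (?V \<union> (U - ?V)) r = order_polynomial ?V r * order_polynomial (U - ?V) r"
  proof (rule order_polynomial_disjoint_Un)
    fix a b assume a: "a \<in> ?V" and b: "b \<in> U - ?V"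
    have "(v, b) \<notin> r" using b UA by auto
    moreover from this have "(b, v) \<notin> r" using min[of b] b by blast
    ultimately show "(a, b) \<notin> r \<and> (b, a) \<notin> r"
      using a transD[OF r(2), of v a b] forest[of b a v] by blast
  qed (use fin VU finite_subset in auto)
  moreover have "?V \<union> (U - ?V) = U" using VU by blast
  ultimately have "order_polynomial U r = order_polynomial ?V r * order_polynomial (U - ?V) r" by simp
  moreover have "coeff (order_polynomial ?V r) 0 = 0" "coeff (order_polynomial (U - ?V) r) 0 = 0"
    using poly_order_polynomial_0[of ?V r] poly_order_polynomial_0[of "U - ?V" r]
      \<open>v \<in> ?V\<close> rest fin finite_subset[OF VU fin] by (auto simp: poly_0_coeff_0)
  ultimately show ?thesis by (simp add: coeff_mult)
qed simp

lemma pderiv_order_polynomial_forest: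
  assumes "finite A" and r: "refl r" "trans r" "antisym r"
    and forest: "\<And>u v w. (u, w) \<in> r \<Longrightarrow> (v, w) \<in> r \<Longrightarrow> (u, v) \<in> r \<or> (v, u) \<in> r"
  shows "pderiv (order_polynomial A r) = (\<Sum>v\<in>A. smult
    (coeff (order_polynomial {w \<in> A. (v, w) \<in> r} r) 1) (order_polynomial (A - {w \<in> A. (v, w) \<in> r}) r))"
proof -
  let ?up = "\<lambda>v. {w \<in> A. (v, w) \<in> r}"
  let ?t = "\<lambda>U. smult (coeff (order_polynomial U r) 1) (order_polynomial (A - U) r)"
  have "?up v \<in> upsets A r" for v using transD[OF r(2)] by (auto simp: upsets_def)
  then have sub: "?up ` A \<subseteq> upsets A r" by blast
  have "inj_on ?up A"
  proof (rule inj_onI)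
    fix v w assume "v \<in> A" "w \<in> A" "?up v = ?up w"
    then have "(v, w) \<in> r" "(w, v) \<in> r" using r(1) by (auto simp: refl_on_def)
    then show "v = w" using antisymD[OF r(3)] by blast
  qed
  have "pderiv (order_polynomial A r) = (\<Sum>U\<in>upsets A r. ?t U)"
    by (rule pderiv_order_polynomial[OF assms(1)])
  also have "\<dots> = (\<Sum>U\<in>?up ` A. ?t U)"
  proof (rule sum.mono_neutral_right[OF finite_upsets[OF assms(1)] sub], rule ballI)
    fix U assume "U \<in> upsets A r - ?up ` A"
    then have "coeff (order_polynomial U r) 1 = 0"
      by (intro coeff_1_order_polynomial_not_principal[of A U r] assms) auto
    then show "?t U = 0" by simp
  qed
  also have "\<dots> = (\<Sum>v\<in>A. ?t (?up v))"
    by (subst sum.reindex[OF \<open>inj_on ?up A\<close>]) simp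
  finally show ?thesis .
qed

section \<open>The order polynomial of a tree without its root\<close>

text \<open>
  For \<open>T = B_+(F)\<close> this is \<open>\<Omega>(F)\<close>. Reading it off from \<open>T\<close> makes it available for every tree that arises by
  cutting, without choosing a forest \<open>F\<close>.
\<close>

definition tree_poly :: "rgraph \<Rightarrow> rat poly" where
  "tree_poly T = order_polynomial (verts T - {the_root T}) ((edges T)\<^sup>*)"

definition linear_coeff :: "rgraph \<Rightarrow> rat" where
  "linear_coeff T = (if rooted_tree T then coeff (tree_poly T) 1 else 0)"

lemma rtrancl_map_prod_inj_on:
  assumes inj: "inj_on f V" and E: "E \<subseteq> V \<times> V" and uv: "u \<in> V" "v \<in> V"
  shows "(f u, f v) \<in> (map_prod f f ` E)\<^sup>* \<longleftrightarrow> (u, v) \<in> E\<^sup>*"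
proof
  have "\<forall>v\<in>V. y = f v \<longrightarrow> (u, v) \<in> E\<^sup>*" if "(f u, y) \<in> (map_prod f f ` E)\<^sup>*" for y
    using that
  proof (induction rule: rtrancl_induct)
    case base
    show ?case using inj_on_eq_iff[OF inj uv(1)] by auto
  next
    case (step y z)
    obtain a b where ab: "(a, b) \<in> E" "y = f a" "z = f b" using step.hyps(2) by auto
    have V: "a \<in> V" "b \<in> V" using ab(1) E by auto
    have "(u, a) \<in> E\<^sup>*" using step.IH V(1) ab(2) by simp
    then have "(u, b) \<in> E\<^sup>*" using ab(1) by (rule rtrancl_into_rtrancl)
    then show ?case using inj_on_eq_iff[OF inj V(2)] ab(3) by auto
  qed
  then show "(f u, f v) \<in> (map_prod f f ` E)\<^sup>* \<Longrightarrow> (u, v) \<in> E\<^sup>*" using uv(2) by simp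
next
  assume "(u, v) \<in> E\<^sup>*"
  then show "(f u, f v) \<in> (map_prod f f ` E)\<^sup>*"
  proof (induction rule: rtrancl_induct)
    case base
    show ?case by (rule rtrancl_refl)
  next
    case (step y z)
    have "(f y, f z) \<in> map_prod f f ` E" using step.hyps(2) by (rule rev_image_eqI) simp
    with step.IH show ?case by (rule rtrancl_into_rtrancl)
  qed
qed

lemma tree_poly_iso:
  assumes G: "rooted_tree G" and "G \<cong> H"
  shows "tree_poly G = tree_poly H"
proof -
  obtain f where bij: "bij_betw f (verts G) (verts H)" and E: "edges H = map_prod f f ` edges G"
    using assms(2) by (auto simp: iso_def)
  have inj: "inj_on f (verts G)" and im: "f ` verts G = verts H"
    using bij by (auto simp: bij_betw_def)
  have sub: "edges G \<subseteq> verts G \<times> verts G" using G by (simp add: rooted_tree_def rooted_forest_def)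
  have parent: "(\<exists>y. (y, f v) \<in> edges H) \<longleftrightarrow> (\<exists>u. (u, v) \<in> edges G)" if "v \<in> verts G" for v
  proof
    assume "\<exists>y. (y, f v) \<in> edges H"
    then obtain a b where ab: "(a, b) \<in> edges G" "f b = f v" by (auto simp: E)
    then have "b = v" using inj_onD[OF inj, of b v] sub that by blast
    then show "\<exists>u. (u, v) \<in> edges G" using ab by blast
  next
    assume "\<exists>u. (u, v) \<in> edges G"
    then show "\<exists>y. (y, f v) \<in> edges H" unfolding E by force
  qed
  have "roots H = f ` roots G"
    unfolding roots_def im[symmetric] using parent by blast
  then have "roots H = {f (the_root G)}" using roots_eq_the_root[OF G] by simp
  then have "the_root H = f (the_root G)" by (simp add: the_root_def)
  then have "verts H - {the_root H} = f ` (verts G - {the_root G})"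
    using inj_on_image_set_diff[OF inj, of "verts G" "{the_root G}"] root_in_verts[OF G] im by auto
  moreover have "order_polynomial (f ` (verts G - {the_root G})) ((edges H)\<^sup>*)
    = order_polynomial (verts G - {the_root G}) ((edges G)\<^sup>*)"
  proof (rule order_polynomial_image)
    show "inj_on f (verts G - {the_root G})" by (rule inj_on_subset[OF inj]) blast
  qed (use finite_verts[OF G] rtrancl_map_prod_inj_on[OF inj sub] E in auto)
  ultimately show ?thesis by (simp add: tree_poly_def)
qed

lemma roots_B_plus: "roots (B_plus F) = {0}"
proof -
  have "Suc v \<notin> roots (B_plus F)" if v: "v \<in> verts F" for v
  proof (cases "v \<in> roots F")
    case True
    then have "(0, Suc v) \<in> edges (B_plus F)" by (auto simp: B_plus_def)
    then show ?thesis by (auto simp: roots_def)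
  next
    case False
    then obtain u where "(u, v) \<in> edges F" using v by (auto simp: roots_def)
    then have "(Suc u, Suc v) \<in> edges (B_plus F)" by (auto simp: B_plus_def)
    then show ?thesis by (auto simp: roots_def)
  qed
  moreover have "0 \<in> roots (B_plus F)" by (auto simp: roots_def B_plus_def)
  moreover have "roots (B_plus F) \<subseteq> insert 0 (Suc ` verts F)" by (auto simp: roots_def B_plus_def)
  ultimately show ?thesis by blast
qed

lemma rooted_tree_B_plus:
  assumes "rooted_forest F"
  shows "rooted_tree (B_plus F)"
proof -
  have F: "finite (verts F)" "edges F \<subseteq> verts F \<times> verts F" "acyclic (edges F)"
    "single_valued ((edges F)\<inverse>)"
    using assms by (auto simp: rooted_forest_def)
  \<comment> \<open>No walk returns to the new root \<open>0\<close>, and a walk that starts elsewhere is a shifted walk in \<open>F\<close>.\<close>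
  have walk: "y \<noteq> 0 \<and> (x = 0 \<or> (\<exists>u v. x = Suc u \<and> y = Suc v \<and> (u, v) \<in> (edges F)\<^sup>+))"
    if "(x, y) \<in> (edges (B_plus F))\<^sup>+" for x y
    using that
  proof (induction rule: trancl_induct)
    case (base y)
    then show ?case by (auto simp: B_plus_def)
  next
    case (step y z)
    then show ?case by (auto simp: B_plus_def intro: trancl_into_trancl)
  qed
  have "acyclic (edges (B_plus F))"
    using F(3) walk unfolding acyclic_def by blast
  moreover have "single_valued ((edges (B_plus F))\<inverse>)"
    using F(4) unfolding single_valued_def B_plus_def roots_def by auto
  moreover have "edges (B_plus F) \<subseteq> verts (B_plus F) \<times> verts (B_plus F)"
    using F(2) by (auto simp: B_plus_def roots_def)
  ultimately have "rooted_forest (B_plus F)" using F(1) by (simp add: rooted_forest_def B_plus_def)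
  then show ?thesis using roots_B_plus by (auto simp: rooted_tree_def)
qed

lemma tree_poly_B_plus:
  assumes "rooted_forest F"
  shows "tree_poly (B_plus F) = order_polynomial (verts F) ((edges F)\<^sup>*)"
proof -
  have F: "edges F \<subseteq> verts F \<times> verts F" "finite (verts F)"
    using assms by (auto simp: rooted_forest_def)
  have "the_root (B_plus F) = 0" using roots_B_plus by (simp add: the_root_def)
  then have "verts (B_plus F) - {the_root (B_plus F)} = Suc ` verts F" by (auto simp: B_plus_def)
  moreover have "order_polynomial (Suc ` verts F) ((edges (B_plus F))\<^sup>*)
    = order_polynomial (verts F) ((edges F)\<^sup>*)"
  proof (rule order_polynomial_image[OF F(2)])
    fix a b assume ab: "a \<in> verts F" "b \<in> verts F"
    have "y \<noteq> 0 \<and> (Suc a, y) \<in> (map_prod Suc Suc ` edges F)\<^sup>*"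
      if "(Suc a, y) \<in> (edges (B_plus F))\<^sup>*" for y
      using that
    proof (induction rule: rtrancl_induct)
      case (step y z)
      then have "(y, z) \<in> map_prod Suc Suc ` edges F" by (auto simp: B_plus_def)
      then show ?case using step.IH rtrancl_into_rtrancl[of "Suc a" y _ z] by auto
    qed simp
    moreover have "(map_prod Suc Suc ` edges F)\<^sup>* \<subseteq> (edges (B_plus F))\<^sup>*"
      by (rule rtrancl_mono) (simp add: B_plus_def)
    ultimately show "(Suc a, Suc b) \<in> (edges (B_plus F))\<^sup>* \<longleftrightarrow> (a, b) \<in> (edges F)\<^sup>*"
      using rtrancl_map_prod_inj_on[of Suc "verts F" "edges F" a b] F(1) ab by auto
  qed simp
  ultimately show ?thesis by (simp add: tree_poly_def)
qed

section \<open>Cutting an edge\<close>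

text \<open>The vertices of \<open>cut_R T e\<close> form a lower set, so every walk that ends there stays there.\<close>

lemma cut_R_rtrancl:
  assumes T: "rooted_tree T" and e: "e \<in> edges T" and "v \<in> verts (cut_R T e)"
  shows "(u, v) \<in> (edges (cut_R T e))\<^sup>* \<longleftrightarrow> (u, v) \<in> (edges T)\<^sup>*"
proof
  show "(u, v) \<in> (edges (cut_R T e))\<^sup>* \<Longrightarrow> (u, v) \<in> (edges T)\<^sup>*"
    using edges_cut_R[OF T e] rtrancl_mono[of "edges (cut_R T e)" "edges T"] by blast
  assume "(u, v) \<in> (edges T)\<^sup>*"
  then show "(u, v) \<in> (edges (cut_R T e))\<^sup>*" using assms(3)
  proof (induction rule: rtrancl_induct)
    case (step y z)
    have "y \<in> verts T" using step.hyps(2) T by (auto simp: rooted_tree_def rooted_forest_def)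
    then have "y \<in> verts (cut_R T e)"
      using step.hyps(2) step.prems rtrancl_into_rtrancl[of "snd e" y "edges T" z]
      unfolding verts_cut(1)[OF T e] by blast
    then have "(y, z) \<in> edges (cut_R T e)"
      using step.hyps(2) step.prems edges_cut_R[OF T e] by blast
    then show ?case using step.IH[OF \<open>y \<in> verts (cut_R T e)\<close>] by simp
  qed simp
qed

lemma the_root_cut_R:
  assumes T: "rooted_tree T" and e: "e \<in> edges T"
  shows "the_root (cut_R T e) = the_root T"
proof -
  have "the_root T \<in> verts (cut_R T e)"
    by (simp add: cut_R_def reachable_part_def delete_edge_def Let_def root_in_verts[OF T])
  then have "the_root T \<in> roots (cut_R T e)"
    using no_edge_to_root[OF T] edges_cut_R[OF T e] by (auto simp: roots_def)
  then show ?thesis using roots_eq_the_root[OF rooted_tree_cut_R[OF T e]] by simp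
qed

lemma tree_poly_cut_R:
  assumes T: "rooted_tree T" and e: "e \<in> edges T"
  shows "tree_poly (cut_R T e)
    = order_polynomial (verts (cut_R T e) - {the_root T}) ((edges T)\<^sup>*)"
  using order_polynomial_image[of "verts (cut_R T e) - {the_root T}" id "(edges (cut_R T e))\<^sup>*" "(edges T)\<^sup>*"]
    finite_verts[OF rooted_tree_cut_R[OF T e]] cut_R_rtrancl[OF T e]
  by (simp add: tree_poly_def the_root_cut_R[OF T e])

lemma edges_cut_P:
  assumes T: "rooted_tree T" and e: "e \<in> edges T"
  shows "edges (cut_P T e) = edges T \<inter> verts (cut_P T e) \<times> verts (cut_P T e)"
proof -
  have "(snd e, fst e) \<notin> (edges T)\<^sup>*"
    using T e rtrancl_into_trancl1[of "snd e" "fst e" "edges T" "snd e"]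
    by (auto simp: rooted_tree_def rooted_forest_def acyclic_def)
  then have "e \<notin> verts (cut_P T e) \<times> verts (cut_P T e)"
    unfolding verts_cut(2)[OF T e] by (cases e) auto
  then show ?thesis
    by (auto simp: cut_P_def reachable_part_def delete_edge_def Let_def)
qed

lemma rooted_forest_cut_P:
  assumes T: "rooted_tree T" and e: "e \<in> edges T"
  shows "rooted_forest (cut_P T e)"
proof -
  have sub: "edges (cut_P T e) \<subseteq> edges T" using edges_cut_P[OF T e] by blast
  have "acyclic (edges (cut_P T e))"
    by (rule acyclic_subset[OF _ sub]) (use T in \<open>simp add: rooted_tree_def rooted_forest_def\<close>)
  moreover have "single_valued ((edges (cut_P T e))\<inverse>)"
    by (rule single_valued_subset[of _ "(edges T)\<inverse>"])
      (use T sub in \<open>auto simp: rooted_tree_def rooted_forest_def\<close>)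
  ultimately show ?thesis
    using card_cut(4)[OF T e] edges_cut_P[OF T e] by (auto simp: rooted_forest_def)
qed

text \<open>The vertices of \<open>cut_P T e\<close> form an upper set, so every walk that starts there stays there.\<close>

lemma cut_P_rtrancl:
  assumes T: "rooted_tree T" and e: "e \<in> edges T" and u: "u \<in> verts (cut_P T e)"
  shows "(u, v) \<in> (edges (cut_P T e))\<^sup>* \<longleftrightarrow> (u, v) \<in> (edges T)\<^sup>*"
proof
  show "(u, v) \<in> (edges (cut_P T e))\<^sup>* \<Longrightarrow> (u, v) \<in> (edges T)\<^sup>*"
    using edges_cut_P[OF T e] rtrancl_mono[of "edges (cut_P T e)" "edges T"] by blast
  assume "(u, v) \<in> (edges T)\<^sup>*"
  then have "v \<in> verts (cut_P T e) \<and> (u, v) \<in> (edges (cut_P T e))\<^sup>*"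
  proof (induction rule: rtrancl_induct)
    case (step y z)
    have "z \<in> verts T" using step.hyps(2) T by (auto simp: rooted_tree_def rooted_forest_def)
    then have "z \<in> verts (cut_P T e)"
      using step.hyps(2) step.IH rtrancl_into_rtrancl[of "snd e" y "edges T" z]
      unfolding verts_cut(2)[OF T e] by blast
    then have "(y, z) \<in> edges (cut_P T e)"
      using step.hyps(2) step.IH edges_cut_P[OF T e] by blast
    then show ?case using step.IH \<open>z \<in> verts (cut_P T e)\<close> by auto
  qed (use u in simp)
  then show "(u, v) \<in> (edges (cut_P T e))\<^sup>*" by blast
qed

lemma tree_poly_B_plus_cut_P:
  assumes T: "rooted_tree T" and e: "e \<in> edges T"
  shows "tree_poly (B_plus (cut_P T e)) = order_polynomial (verts (cut_P T e)) ((edges T)\<^sup>*)"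
  using order_polynomial_image[of "verts (cut_P T e)" id "(edges (cut_P T e))\<^sup>*" "(edges T)\<^sup>*"]
    card_cut(4)[OF T e] cut_P_rtrancl[OF T e]
  by (simp add: tree_poly_B_plus[OF rooted_forest_cut_P[OF T e]])

lemma linear_coeff_B_plus_cut_P:
  assumes T: "rooted_tree T" and e: "e \<in> edges T"
  shows "linear_coeff (B_plus (cut_P T e)) = coeff (order_polynomial (verts (cut_P T e)) ((edges T)\<^sup>*)) 1"
  by (simp add: linear_coeff_def rooted_tree_B_plus rooted_forest_cut_P[OF T e]
      tree_poly_B_plus_cut_P[OF T e])

section \<open>The differential equation for trees\<close>

lemma rooted_tree_order:
  assumes "rooted_tree T"
  shows "refl ((edges T)\<^sup>*)" "trans ((edges T)\<^sup>*)" "antisym ((edges T)\<^sup>*)"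
    "(u, w) \<in> (edges T)\<^sup>* \<Longrightarrow> (v, w) \<in> (edges T)\<^sup>* \<Longrightarrow> (u, v) \<in> (edges T)\<^sup>* \<or> (v, u) \<in> (edges T)\<^sup>*"
proof -
  show "refl ((edges T)\<^sup>*)" "trans ((edges T)\<^sup>*)" by (rule refl_rtrancl, rule trans_rtrancl)
  show "antisym ((edges T)\<^sup>*)" using assms
    by (simp add: rooted_tree_def rooted_forest_def acyclic_impl_antisym_rtrancl)
  assume "(u, w) \<in> (edges T)\<^sup>*" "(v, w) \<in> (edges T)\<^sup>*"
  then show "(u, v) \<in> (edges T)\<^sup>* \<or> (v, u) \<in> (edges T)\<^sup>*"
    using single_valued_confluent[of "(edges T)\<inverse>" w u v] assms
    by (auto simp: rooted_tree_def rooted_forest_def rtrancl_converse)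
qed

lemma bij_betw_snd_edges:
  assumes T: "rooted_tree T"
  shows "bij_betw snd (edges T) (verts T - {the_root T})"
proof -
  have "inj_on snd (edges T)" using parent_unique[OF T] by (auto simp: inj_on_def)
  moreover have "snd ` edges T = verts T - {the_root T}"
  proof (intro equalityI subsetI)
    fix v assume "v \<in> verts T - {the_root T}"
    then have "v \<in> verts T" "v \<notin> roots T" using roots_eq_the_root[OF T] by auto
    then obtain u where "(u, v) \<in> edges T" by (auto simp: roots_def)
    then show "v \<in> snd ` edges T" by force
  next
    fix v assume "v \<in> snd ` edges T"
    then obtain u where "(u, v) \<in> edges T" by auto
    then show "v \<in> verts T - {the_root T}"
      using T no_edge_to_root[OF T] by (auto simp: rooted_tree_def rooted_forest_def)
  qed
  ultimately show ?thesis by (simp add: bij_betw_def)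
qed

lemma walk_to_root:
  assumes "rooted_tree T" "(v, the_root T) \<in> (edges T)\<^sup>*"
  shows "v = the_root T"
  using assms(2) by (cases rule: rtranclE) (simp_all add: no_edge_to_root[OF assms(1)])

lemma verts_cut_P_eq:
  assumes T: "rooted_tree T" and e: "e \<in> edges T"
  shows "verts (cut_P T e) = {w \<in> verts T - {the_root T}. (snd e, w) \<in> (edges T)\<^sup>*}"
proof -
  have "snd e \<noteq> the_root T" using no_edge_to_root[OF T, of "fst e"] e by (metis prod.collapse)
  then have "(snd e, the_root T) \<notin> (edges T)\<^sup>*" using walk_to_root[OF T] by blast
  then show ?thesis unfolding verts_cut(2)[OF T e] by auto
qed

text \<open>
  The principal upper sets of \<open>T\<close> without its root correspond to the edges of \<open>T\<close>: the elements above the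
  end \<open>snd e\<close> of an edge are the vertices of the branch that is cut off at \<open>e\<close>.
\<close>

lemma pderiv_tree_poly:
  assumes T: "rooted_tree T"
  shows "pderiv (tree_poly T)
    = (\<Sum>e\<in>edges T. smult (linear_coeff (B_plus (cut_P T e))) (tree_poly (cut_R T e)))"
proof -
  let ?r = "(edges T)\<^sup>*" and ?A = "verts T - {the_root T}"
  let ?up = "\<lambda>v. {w \<in> ?A. (v, w) \<in> ?r}"
  let ?t = "\<lambda>v. smult (coeff (order_polynomial (?up v) ?r) 1) (order_polynomial (?A - ?up v) ?r)"
  have "pderiv (tree_poly T) = (\<Sum>v\<in>?A. ?t v)"
    unfolding tree_poly_def
    by (rule pderiv_order_polynomial_forest)
      (use rooted_tree_order[OF T] finite_verts[OF T] in auto)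
  also have "\<dots> = (\<Sum>e\<in>edges T. ?t (snd e))"
    by (rule sum.reindex_bij_betw[OF bij_betw_snd_edges[OF T], symmetric])
  also have "\<dots> = (\<Sum>e\<in>edges T. smult (linear_coeff (B_plus (cut_P T e))) (tree_poly (cut_R T e)))"
  proof (rule sum.cong[OF refl])
    fix e assume e: "e \<in> edges T"
    have "?A - ?up (snd e) = verts (cut_R T e) - {the_root T}"
      unfolding verts_cut(1)[OF T e] by auto
    then show "?t (snd e) = smult (linear_coeff (B_plus (cut_P T e))) (tree_poly (cut_R T e))"
      by (simp only: linear_coeff_B_plus_cut_P[OF T e] tree_poly_cut_R[OF T e] verts_cut_P_eq[OF T e])
  qed
  finally show ?thesis .
qed

section \<open>Coefficients as sums over cut sequences\<close>

text \<open>
  For the direction from right to left, the relation \<open>\<succ>\<close> has to be carried over from \<open>cut_R T e\<close> to \<open>T\<close>,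
  which works because reachability in \<open>cut_R T e\<close> is that of \<open>T\<close>.
\<close>

lemma cut_sequences_Cons_iff:
  assumes T: "rooted_tree T"
  shows "e # es \<in> cut_sequences T (Suc k) \<longleftrightarrow> e \<in> edges T \<and> es \<in> cut_sequences (cut_R T e) k"
proof
  show "e \<in> edges T \<and> es \<in> cut_sequences (cut_R T e) k" if "e # es \<in> cut_sequences T (Suc k)"
    using cut_sequences_Cons[OF T that] by blast
next
  assume "e \<in> edges T \<and> es \<in> cut_sequences (cut_R T e) k"
  then have e: "e \<in> edges T" and es: "length es = k" "set es \<subseteq> edges (cut_R T e)"
    and sorted: "sorted_wrt (\<lambda>a b. b \<in> edges (cut_R (cut_R T e) a)) es"
    by (auto simp: cut_sequences_def)
  have R: "rooted_tree (cut_R T e)" by (rule rooted_tree_cut_R[OF T e])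
  have sub: "set es \<subseteq> edges T" using es(2) edges_cut_R[OF T e] by blast
  have step: "b \<in> edges (cut_R T a)" if a: "a \<in> set es" and b: "b \<in> edges (cut_R (cut_R T e) a)" for a b
  proof -
    have aR: "a \<in> edges (cut_R T e)" and aT: "a \<in> edges T" using a es(2) sub by auto
    have "verts (cut_R (cut_R T e) a) \<subseteq> verts (cut_R T a)"
    proof
      fix w assume "w \<in> verts (cut_R (cut_R T e) a)"
      then have w: "w \<in> verts (cut_R T e)" "(snd a, w) \<notin> (edges (cut_R T e))\<^sup>*"
        unfolding verts_cut(1)[OF R aR] by blast+
      then have "(snd a, w) \<notin> (edges T)\<^sup>*" using cut_R_rtrancl[OF T e] by blast
      moreover have "w \<in> verts T" using w(1) unfolding verts_cut(1)[OF T e] by blast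
      ultimately show "w \<in> verts (cut_R T a)" unfolding verts_cut(1)[OF T aT] by blast
    qed
    then show ?thesis
      using b unfolding edges_cut_R[OF T aT] edges_cut_R[OF R aR] edges_cut_R[OF T e] by blast
  qed
  have "sorted_wrt (\<lambda>a b. b \<in> edges (cut_R T a)) es"
    by (rule sorted_wrt_mono_rel[OF _ sorted]) (rule step)
  then show "e # es \<in> cut_sequences T (Suc k)"
    using e es sub by (auto simp: cut_sequences_def)
qed

definition cut_sum :: "rgraph \<Rightarrow> nat \<Rightarrow> rat" where
  "cut_sum T k = (\<Sum>es\<in>cut_sequences T k. prod_list (map linear_coeff (pieces T es)))"

lemma finite_edges: "rooted_tree T \<Longrightarrow> finite (edges T)"
  using finite_subset[of "edges T" "verts T \<times> verts T"] by (simp add: rooted_tree_def rooted_forest_def)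

lemma finite_cut_sequences: "rooted_tree T \<Longrightarrow> finite (cut_sequences T k)"
  by (rule finite_subset[OF _ finite_lists_length_eq[of "edges T" k]])
    (auto simp: cut_sequences_def finite_edges)

lemma cut_sum_0: "cut_sum T 0 = linear_coeff T"
proof -
  have "cut_sequences T 0 = {[]}" by (auto simp: cut_sequences_def)
  then show ?thesis by (simp add: cut_sum_def)
qed

lemma cut_sum_Suc:
  assumes T: "rooted_tree T"
  shows "cut_sum T (Suc k)
    = (\<Sum>e\<in>edges T. linear_coeff (B_plus (cut_P T e)) * cut_sum (cut_R T e) k)"
proof -
  have "cut_sequences T (Suc k)
    = (\<lambda>(e, es). e # es) ` (SIGMA e:edges T. cut_sequences (cut_R T e) k)" (is "_ = _ ` ?S")
  proof (intro equalityI subsetI)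
    fix xs assume xs: "xs \<in> cut_sequences T (Suc k)"
    then obtain e es where "xs = e # es" by (cases xs) (auto simp: cut_sequences_def)
    moreover from this have "(e, es) \<in> ?S" using xs cut_sequences_Cons_iff[OF T] by simp
    ultimately show "xs \<in> (\<lambda>(e, es). e # es) ` ?S" by (auto intro: rev_image_eqI)
  qed (auto simp: cut_sequences_Cons_iff[OF T])
  moreover have "inj_on (\<lambda>(e, es). e # es) ?S" by (auto simp: inj_on_def)
  ultimately have "cut_sum T (Suc k)
    = (\<Sum>(e, es)\<in>?S. linear_coeff (B_plus (cut_P T e))
        * prod_list (map linear_coeff (pieces (cut_R T e) es)))"
    by (simp add: cut_sum_def sum.reindex case_prod_unfold)
  also have "\<dots> = (\<Sum>e\<in>edges T. linear_coeff (B_plus (cut_P T e)) * cut_sum (cut_R T e) k)"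
    using finite_edges[OF T] finite_cut_sequences[OF rooted_tree_cut_R[OF T]]
    by (subst sum.Sigma[symmetric]) (simp_all add: cut_sum_def sum_distrib_left)
  finally show ?thesis .
qed

text \<open>
  Both sides satisfy the same recursion in \<open>k\<close>: comparing coefficients in \<open>pderiv_tree_poly\<close> splits off the factor of
  the first cut, and so does \<open>cut_sum_Suc\<close>.
\<close>

lemma coeff_tree_poly:
  assumes "rooted_tree T"
  shows "coeff (tree_poly T) (Suc k) = cut_sum T k / fact (Suc k)"
  using assms
proof (induction k arbitrary: T)
  case 0
  then show ?case by (simp add: cut_sum_0 linear_coeff_def)
next
  case (Suc k)
  have "of_nat (Suc (Suc k)) * coeff (tree_poly T) (Suc (Suc k)) = coeff (pderiv (tree_poly T)) (Suc k)"
    by (simp add: coeff_pderiv)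
  also have "\<dots> = (\<Sum>e\<in>edges T. linear_coeff (B_plus (cut_P T e)) * coeff (tree_poly (cut_R T e)) (Suc k))"
    by (simp add: pderiv_tree_poly[OF Suc.prems] coeff_sum)
  also have "\<dots> = (\<Sum>e\<in>edges T. linear_coeff (B_plus (cut_P T e)) * (cut_sum (cut_R T e) k / fact (Suc k)))"
    using Suc.IH rooted_tree_cut_R[OF Suc.prems] by (intro sum.cong) auto
  also have "\<dots> = cut_sum T (Suc k) / fact (Suc k)"
    by (simp add: cut_sum_Suc[OF Suc.prems] sum_divide_distrib)
  finally have "of_nat (Suc (Suc k)) * coeff (tree_poly T) (Suc (Suc k)) = cut_sum T (Suc k) / fact (Suc k)" .
  then have "coeff (tree_poly T) (Suc (Suc k)) = cut_sum T (Suc k) / fact (Suc k) / of_nat (Suc (Suc k))"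
    by (simp only: eq_divide_eq) (simp add: mult.commute)
  then show ?case by (simp only: fact_Suc[of "Suc k"] of_nat_mult divide_divide_eq_left mult.commute)
qed

text \<open>
  The coefficients of \<open>tree_poly T\<close> add up to its value at \<open>1\<close>. The constant coefficient is \<open>0\<close> as \<open>T\<close> has a vertex
  other than its root, and those beyond the number of vertices vanish for lack of cut sequences.
\<close>

lemma sum_cut_sum_eq_1:
  assumes T: "rooted_tree T" and "card (verts T) \<ge> 2"
  shows "(\<Sum>m = 1..card (verts T). cut_sum T (m - 1) / fact m) = 1"
proof -
  let ?N = "card (verts T)"
  let ?A = "verts T - {the_root T}"
  have fin: "finite ?A" using finite_verts[OF T] by simp
  have "?A \<noteq> {}" using assms(2) card_mono[of "{the_root T}" "verts T"] by auto
  then have c0: "coeff (tree_poly T) 0 = 0"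
    using poly_order_polynomial_0[OF fin] by (simp add: tree_poly_def poly_0_coeff_0)
  have "coeff (tree_poly T) i = 0" if "i > ?N" for i
  proof -
    obtain k where k: "i = Suc k" using \<open>i > ?N\<close> by (cases i) auto
    then have "?N \<le> k" using \<open>i > ?N\<close> by simp
    then show ?thesis by (simp add: k coeff_tree_poly[OF T] cut_sum_def cut_sequences_empty[OF T])
  qed
  then have "degree (tree_poly T) \<le> ?N" by (simp add: degree_le)
  then have "(\<Sum>i\<le>degree (tree_poly T). coeff (tree_poly T) i) = (\<Sum>i\<le>?N. coeff (tree_poly T) i)"
    by (intro sum.mono_neutral_left) (auto simp: coeff_eq_0)
  then have "poly (tree_poly T) 1 = (\<Sum>i\<le>?N. coeff (tree_poly T) i)"
    by (simp add: poly_altdef)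
  also have "\<dots> = (\<Sum>m = 1..?N. coeff (tree_poly T) m)"
    using c0 by (intro sum.mono_neutral_right) (auto simp: Suc_le_eq intro: gr0I)
  also have "\<dots> = (\<Sum>m = 1..?N. cut_sum T (m - 1) / fact m)"
  proof (rule sum.cong[OF refl])
    fix m assume "m \<in> {1..?N}"
    then obtain k where "m = Suc k" by (cases m) auto
    then show "coeff (tree_poly T) m = cut_sum T (m - 1) / fact m" using coeff_tree_poly[OF T, of k] by simp
  qed
  finally show ?thesis using poly_order_polynomial_1[OF fin] by (simp add: tree_poly_def)
qed

section \<open>The constants theta\<close>

text \<open>
  In the generic case this is \<open>sum_cut_sum_eq_1\<close> with the summand \<open>m = 1\<close>, which is \<open>linear_coeff T\<close> itself, moved to
  the other side.
\<close>

lemma theta_spec_linear_coeff: "theta_spec linear_coeff"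
  unfolding theta_spec_def
proof
  fix T
  let ?A = "verts T - {the_root T}" and ?r = "(edges T)\<^sup>*"
  let ?rhs = "if \<not> rooted_tree T then 0
     else if T \<cong> one_vertex \<or> card (children T (the_root T)) > 1 then 0
     else if T \<cong> B_plus one_vertex then 1
     else 1 - (\<Sum>m = 2..card (verts T).
        1 / fact m * (\<Sum>es\<in>cut_sequences T (m - 1). prod_list (map linear_coeff (pieces T es))))"
  consider "\<not> rooted_tree T" | "rooted_tree T" "T \<cong> one_vertex"
    | "rooted_tree T" "card (children T (the_root T)) > 1"
    | "rooted_tree T" "\<not> T \<cong> one_vertex" "\<not> card (children T (the_root T)) > 1" "T \<cong> B_plus one_vertex"
    | "rooted_tree T" "\<not> T \<cong> one_vertex" "\<not> card (children T (the_root T)) > 1" "\<not> T \<cong> B_plus one_vertex"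
    by blast
  then show "linear_coeff T = ?rhs"
  proof cases
    case 1
    then show ?thesis by (simp add: linear_coeff_def)
  next
    case 2
    have "rooted_forest empty_forest" by (simp add: rooted_forest_def empty_forest_def acyclic_def)
    then have "tree_poly T = 1"
      using tree_poly_iso[OF 2] by (simp add: tree_poly_B_plus) (simp add: empty_forest_def)
    then show ?thesis using 2 by (simp add: linear_coeff_def)
  next
    case 3
    \<comment> \<open>If the upper set of all vertices other than the root were principal, its least element would be the only child.\<close>
    have "coeff (tree_poly T) 1 = 0"
      unfolding tree_poly_def
    proof (rule coeff_1_order_polynomial_not_principal[of ?A])
      show "?A \<in> upsets ?A ?r" by (simp add: upsets_def)
      fix v assume v: "v \<in> ?A"
      show "?A \<noteq> {w \<in> ?A. (v, w) \<in> ?r}"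
      proof
        assume eq: "?A = {w \<in> ?A. (v, w) \<in> ?r}"
        have "c = v" if c: "(the_root T, c) \<in> edges T" for c
        proof -
          have "c \<in> ?A" using c 3(1) no_edge_to_root[OF 3(1)]
            by (auto simp: rooted_tree_def rooted_forest_def)
          then have "(v, c) \<in> ?r" using eq by blast
          then show "c = v"
          proof (cases rule: rtranclE)
            case (step p)
            then have "p = the_root T" using parent_unique[OF 3(1) _ c] by blast
            then have "v = the_root T" using step(1) walk_to_root[OF 3(1)] by blast
            then show ?thesis using v by simp
          qed simp
        qed
        then have "children T (the_root T) \<subseteq> {v}" by (auto simp: children_def)
        then show False using 3(2) card_mono[of "{v}" "children T (the_root T)"] by simp
      qed
    qed (use rooted_tree_order[OF 3(1)] finite_verts[OF 3(1)] in auto)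
    then show ?thesis using 3 by (simp add: linear_coeff_def)
  next
    case 4
    have "rooted_forest one_vertex"
      using rooted_tree_B_plus[of empty_forest]
      by (simp add: rooted_tree_def rooted_forest_def empty_forest_def acyclic_def)
    then have "tree_poly T = [:0, 1:]"
      using tree_poly_iso[OF 4(1,4)]
      by (simp add: tree_poly_B_plus) (simp add: B_plus_def empty_forest_def order_polynomial_singleton)
    then show ?thesis using 4 by (simp add: linear_coeff_def)
  next
    case 5
    have "card (verts T) > 0" using root_in_verts[OF 5(1)] finite_verts[OF 5(1)] by (auto simp: card_gt_0_iff)
    moreover have "card (verts T) \<noteq> 1" using rooted_tree_card_1_iso[OF 5(1)] 5(2) by blast
    ultimately have ge: "card (verts T) \<ge> 2" by linarith
    then have "1 = cut_sum T 0 + (\<Sum>m = 2..card (verts T). cut_sum T (m - 1) / fact m)"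
      using sum_cut_sum_eq_1[OF 5(1) ge] by (simp add: sum.atLeast_Suc_atMost numeral_2_eq_2)
    then show ?thesis using 5 by (simp add: cut_sum_0) (simp add: cut_sum_def)
  qed
qed

theorem proposition5p8:
  fixes T F :: rgraph
  assumes "rooted_tree T" and "rooted_forest F" and "T \<cong> B_plus F"
  shows "theta T = varphi F"
proof -
  have "theta = linear_coeff"
    using theta_spec_ex1 theta_spec_theta theta_spec_linear_coeff by blast
  moreover have "tree_poly T = order_polynomial (verts F) ((edges F)\<^sup>*)"
    using tree_poly_iso[OF assms(1,3)] tree_poly_B_plus[OF assms(2)] by simp
  moreover have "Omega F = order_polynomial (verts F) ((edges F)\<^sup>*)"
    using order_polynomial_image[of "verts F" id "(edges F)\<^sup>*" "forest_order F"] assms(2)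
    by (simp add: Omega_def forest_order_eq rooted_forest_def)
  ultimately show ?thesis using assms(1) by (simp add: linear_coeff_def varphi_eq_coeff)
qed

end
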